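(* Let $h$ be a positive integer. There exists a multiplicative basis $A$ of order $h$ for $\mathbb{Z}^+$ such that $$\limsup_{x\to\infty}A(x)\frac{(\log x)^{1-\frac1h}}{x}=\frac{h}{\Gamma\left(\frac1h\right)}.$$
   Context: $\mathbb{Z}^+$ denotes the set of positive integers, $\log$ the natural logarithm, and $\Gamma$ the Euler gamma function. A set $A\subseteq\mathbb{Z}^+$ is a multiplicative basis of order $h$ for $\mathbb{Z}^+$ if every positive integer can be written in the form $a_1\cdots a_h$ with $a_i\in A$ for all $1\le i\le h$ (repetitions allowed). The counting function of $A$ is $A(x)=|\{a\in A:a\le x\}|$. *)

theory Defs
  imports "HOL-Analysis.Analysis"
begin

definition multiplicative_basis :: "nat \<Rightarrow> nat set \<Rightarrow> bool" where
  "multiplicative_basis h A \<longleftrightarrow>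
     A \<subseteq> {0<..} \<and>
     (\<forall>n>0. \<exists>a :: nat \<Rightarrow> nat. (\<forall>i\<in>{1..h}. a i \<in> A) \<and> n = (\<Prod>i=1..h. a i))"

definition counting_function :: "nat set \<Rightarrow> real \<Rightarrow> nat" where
  "counting_function A x = card {a \<in> A. real a \<le> x}"

end

theory Submission
  imports Defs "HOL-Number_Theory.Prime_Powers" "HOL-Computational_Algebra.Squarefree"
    "HOL-Real_Asymp.Real_Asymp"
begin

text \<open>
  Distribute the primes over \<open>h\<close> classes greedily, giving each prime \<open>p\<close> to the class with the least
  load, where \<open>p\<close> weighs \<open>- ln (1 - 1 / p)\<close>. The basis consists of the integers all of whose prime
  factors lie in a single class. The loads differ by \<open>o(1 / ln n)\<close>, which has two consequences.
  The Dirichlet series \<open>F\<close> of the \<open>h\<close> classes, whose product is the zeta function, have pairwise ratios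
  tending to 1 at \<open>s = 1\<close>, so each of them is asymptotic to \<open>(s - 1) powr (- 1 / h)\<close>. Moreover, the
  Chebyshev functions of the classes agree up to \<open>o(n)\<close>.

  Karamata's theorem turns the first fact into \<open>L(N) = (\<Sum>n\<le>N. f n / n) \<sim> (ln N) powr (1 / h) / \<Gamma>(1 + 1 / h)\<close>
  for the indicator function \<open>f\<close> of a class. To pass from \<open>L\<close> to the counting function of \<open>f\<close> without
  the prime number theorem, write \<open>f = 1 * g\<close> with \<open>\<bar>g\<bar> \<le> 1\<close>. In \<open>f * \<Lambda> = ln * g\<close> the primes enter
  only through \<open>g\<close>, so that Stirling's formula gives \<open>(\<Sum>m\<le>N. f m * \<psi>(N / m)) = N * L(N) + O(N)\<close>. By the
  second fact the left-hand side is asymptotic to \<open>h * (\<Sum>n\<le>N. f n * ln n)\<close>.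
\<close>

section \<open>Integers composed of primes from a given set\<close>

text \<open>The rate o(1 / ln n) is the crux. Partial summation trades the weight of a prime, about
  1 / p, for ln p at the price of a factor n * ln n, so loads that merely agree in the limit would
  say nothing about the Chebyshev functions. Once enough weight has been handed out, a greedy spread
  is at most the largest recent weight. For a spread of e / ln n the primes up to about (1 / e) * ln
  n may therefore be ignored, provided that the weight between this point and n tends to infinity.
  The Euler product gives at least ln (ln n) up to n. Bounding the ignored part by a sum over all
  integers would cost ln (ln n) + O(1) and leave nothing; dropping the even numbers halves this
  cost, which suffices. The weight - ln (1 - 1 / p) is the logarithm of the Euler factor at 1, so
  loads are logarithms of Euler products.

  In the passage to the counting function every error is O(N) or a small multiple of N * L(N), while
  L(N) tends to infinity. Since (1 / h) / Gamma(1 + 1 / h) = 1 / Gamma(1 / h) and the classes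
  overlap only in the number 1, the h counts add up to the stated constant; the limit superior is in
  fact a limit.\<close>

definition gen_ind :: "nat set \<Rightarrow> nat \<Rightarrow> real" where
  "gen_ind P n = of_bool (n > 0 \<and> prime_factors n \<subseteq> P)"

text \<open>With \<open>Q = - P\<close> this is the function called g in the overview: the Moebius
  function cut down to integers built from primes outside \<open>P\<close>. Squarefreeness also
  excludes \<open>d = 0\<close>.\<close>

definition gen_moebius :: "nat set \<Rightarrow> nat \<Rightarrow> real" where
  "gen_moebius Q d =
     (if squarefree d \<and> prime_factors d \<subseteq> Q then (-1) ^ card (prime_factors d) else 0)"

lemma gen_ind_nonneg [simp]: "gen_ind P n \<ge> 0"
  and gen_ind_le_1 [simp]: "gen_ind P n \<le> 1"
  and gen_ind_0 [simp]: "gen_ind P 0 = 0"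
  and gen_ind_1 [simp]: "gen_ind P (Suc 0) = 1"
  by (auto simp: gen_ind_def)

lemma gen_ind_mult: "gen_ind P (m * n) = gen_ind P m * gen_ind P n"
  by (cases "m = 0 \<or> n = 0") (auto simp: gen_ind_def prime_factors_product)

lemma abs_gen_moebius_le_1: "\<bar>gen_moebius Q d\<bar> \<le> 1"
  by (auto simp: gen_moebius_def)

lemma sum_minus_one_power_card_Pow:
  assumes "finite S"
  shows "(\<Sum>T\<in>Pow S. (-1) ^ card T) = (of_bool (S = {}) :: real)"
  using assms
proof induction
  case (insert x S)
  have "(\<Sum>T\<in>Pow (insert x S). (-1) ^ card T :: real) =
      (\<Sum>T\<in>Pow S. (-1) ^ card T) + (\<Sum>T\<in>insert x ` Pow S. (-1) ^ card T)"
    unfolding Pow_insert using insert.hyps by (intro sum.union_disjoint) auto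
  also have "(\<Sum>T\<in>insert x ` Pow S. (-1) ^ card T :: real) = (\<Sum>T\<in>Pow S. (-1) ^ card (insert x T))"
    using insert.hyps by (subst sum.reindex) (auto simp: inj_on_def o_def)
  also have "\<dots> = (\<Sum>T\<in>Pow S. - ((-1) ^ card T))"
  proof (intro sum.cong refl)
    fix T assume "T \<in> Pow S"
    then have "finite T" "x \<notin> T" using insert.hyps by (auto intro: finite_subset)
    then show "(-1) ^ card (insert x T) = - ((-1) ^ card T :: real)" by simp
  qed
  finally show ?case by (simp add: sum_negf)
qed simp

lemma squarefree_eq_prod_prime_factors:
  assumes "squarefree (d::nat)"
  shows "d = \<Prod>(prime_factors d)"
proof -
  have "d \<noteq> 0" using assms by (metis not_squarefree_0)
  then have "d = (\<Prod>p\<in>prime_factors d. p ^ multiplicity p d)"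
    by (simp add: prod_prime_factors)
  also have "\<dots> = \<Prod>(prime_factors d)"
    using assms squarefree_factorial_semiring'[OF \<open>d \<noteq> 0\<close>] by (intro prod.cong) auto
  finally show ?thesis .
qed

text \<open>A squarefree divisor of \<open>n\<close> without primes from \<open>P\<close> is the
  product of a subset of \<open>S = prime_factors n - P\<close>, so the divisor sum is an
  alternating sum over the subsets of \<open>S\<close>. It vanishes unless \<open>S\<close> is
  empty, that is, unless all primes of \<open>n\<close> lie in \<open>P\<close>.\<close>

lemma gen_ind_eq_sum_moebius:
  assumes "n > 0"
  shows "gen_ind P n = (\<Sum>d | d dvd n. gen_moebius (-P) d)"
proof -
  define S where "S = prime_factors n - P"
  have fin: "finite S" by (simp add: S_def)
  have pr: "prime p" if "p \<in> S" for p using that by (auto simp: S_def)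
  have sq: "squarefree (\<Prod>T)" and pf: "prime_factors (\<Prod>T) = T" and dv: "\<Prod>T dvd n" if "T \<subseteq> S" for T
  proof -
    have fT: "finite T" and pT: "\<And>p. p \<in> T \<Longrightarrow> prime p"
      using that fin pr by (auto intro: finite_subset)
    show "squarefree (\<Prod>T)"
      using pT by (intro squarefree_prod_coprime squarefree_prime) (auto intro: primes_coprime)
    have "0 \<notin> T" using pT by (metis not_prime_0)
    then have "prime_factors (\<Prod>T) = (\<Union>p\<in>T. prime_factors p)"
      using fT prime_factors_prod[of T id] by (simp add: o_def)
    also have "\<dots> = T" using pT by (auto simp: prime_prime_factors)
    finally show "prime_factors (\<Prod>T) = T" .
    show "\<Prod>T dvd n"
    proof -
      have "prod (\<lambda>p. p) T dvd (\<Prod>p\<in>prime_factors n. p ^ multiplicity p n)"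
      proof (rule prod_dvd_prod_subset2)
        show "T \<subseteq> prime_factors n" using that by (auto simp: S_def)
        fix p assume "p \<in> T"
        then have "multiplicity p n > 0"
          using that by (auto simp: S_def prime_factors_multiplicity)
        then show "p dvd p ^ multiplicity p n" by simp
      qed auto
      then show ?thesis using assms by (simp add: prod_prime_factors)
    qed
  qed
  have "(\<Sum>d | d dvd n. gen_moebius (-P) d) = (\<Sum>d\<in>Prod ` Pow S. gen_moebius (-P) d)"
  proof (rule sum.mono_neutral_right)
    show "finite {d. d dvd n}" using assms by simp
    show "Prod ` Pow S \<subseteq> {d. d dvd n}" using dv by auto
    show "\<forall>d\<in>{d. d dvd n} - Prod ` Pow S. gen_moebius (-P) d = 0"
    proof
      fix d assume d: "d \<in> {d. d dvd n} - Prod ` Pow S"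
      show "gen_moebius (-P) d = 0"
      proof (rule ccontr)
        assume "gen_moebius (-P) d \<noteq> 0"
        then have "squarefree d" "prime_factors d \<subseteq> -P" by (auto simp: gen_moebius_def split: if_splits)
        moreover have "prime_factors d \<subseteq> prime_factors n"
          using d assms dvd_prime_factors[of n d] by auto
        ultimately have "d = \<Prod>(prime_factors d)" "prime_factors d \<in> Pow S"
          using squarefree_eq_prod_prime_factors by (auto simp: S_def)
        then show False using d by blast
      qed
    qed
  qed
  also have "\<dots> = (\<Sum>T\<in>Pow S. gen_moebius (-P) (\<Prod>T))"
    using pf by (subst sum.reindex) (auto simp: inj_on_def o_def, (metis Pow_iff)+)
  also have "\<dots> = (\<Sum>T\<in>Pow S. (-1) ^ card T)"
  proof (intro sum.cong refl)
    fix T assume T: "T \<in> Pow S"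
    then have "T \<subseteq> -P" by (auto simp: S_def)
    then show "gen_moebius (-P) (\<Prod>T) = (-1) ^ card T"
      using sq[of T] pf[of T] T by (simp add: gen_moebius_def)
  qed
  also have "\<dots> = gen_ind P n"
    using assms by (subst sum_minus_one_power_card_Pow[OF fin]) (auto simp: S_def gen_ind_def)
  finally show ?thesis by simp
qed

lemma sum_divisors_swap:
  fixes g :: "nat \<Rightarrow> nat \<Rightarrow> real"
  shows "(\<Sum>n=1..N. \<Sum>d | d dvd n. g d n) = (\<Sum>d=1..N. \<Sum>k=1..N div d. g d (d * k))"
proof -
  have "(\<Sum>n=1..N. \<Sum>d | d dvd n. g d n) = (\<Sum>(n,d)\<in>(SIGMA n:{1..N}. {d. d dvd n}). g d n)"
    by (subst sum.Sigma) auto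
  also have "\<dots> = (\<Sum>(d,k)\<in>(SIGMA d:{1..N}. {1..N div d}). g d (d * k))"
    by (rule sum.reindex_bij_witness[of _ "\<lambda>(d,k). (d * k, d)" "\<lambda>(n,d). (d, n div d)"])
       (auto simp: div_le_mono dvd_div_eq_0_iff Suc_le_eq dest: dvd_imp_le
         simp: less_eq_div_iff_mult_less_eq mult.commute dvd_pos_nat intro!: Nat.gr0I
         intro: order_trans[OF dvd_imp_le])
  also have "\<dots> = (\<Sum>d=1..N. \<Sum>k=1..N div d. g d (d * k))"
    by (subst sum.Sigma) auto
  finally show ?thesis .
qed

text \<open>Turns a sum restricted to the class into unrestricted sums over the multiples of each
  \<open>d\<close>, which can be evaluated without knowing the class.\<close>

lemma sum_gen_ind_mult:
  "(\<Sum>m=1..N. gen_ind P m * c m) =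
     (\<Sum>d=1..N. gen_moebius (-P) d * (\<Sum>k=1..N div d. c (d * k)))"
proof -
  have "(\<Sum>m=1..N. gen_ind P m * c m) = (\<Sum>m=1..N. \<Sum>d | d dvd m. gen_moebius (-P) d * c m)"
    by (intro sum.cong) (auto simp: gen_ind_eq_sum_moebius sum_distrib_right)
  also have "\<dots> = (\<Sum>d=1..N. \<Sum>k=1..N div d. gen_moebius (-P) d * c (d * k))"
    by (rule sum_divisors_swap)
  finally show ?thesis by (simp add: sum_distrib_left)
qed

section \<open>Chebyshev functions and convolution identities\<close>

definition psi :: "nat \<Rightarrow> real" where
  "psi n = (\<Sum>d=1..n. mangoldt d)"

definition gen_psi :: "nat set \<Rightarrow> nat \<Rightarrow> real" where
  "gen_psi P n = (\<Sum>d=1..n. gen_ind P d * mangoldt d)"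

lemma atLeastAtMost_div_eq:
  assumes "d > 0"
  shows "{1..N div d} = {k\<in>{1..N}. d * k \<le> (N::nat)}"
proof -
  have "k \<le> d * k" for k using assms by simp
  then have "k \<le> N" if "d * k \<le> N" for k using that le_trans by blast
  then show ?thesis
    using assms by (auto simp: less_eq_div_iff_mult_less_eq mult.commute)
qed

text \<open>Both sides sum \<open>u d * v k\<close> over the lattice points under the hyperbola
  \<open>d * k \<le> N\<close>.\<close>

lemma sum_swap_div:
  fixes u v :: "nat \<Rightarrow> real"
  shows "(\<Sum>d=1..N. u d * (\<Sum>k=1..N div d. v k)) = (\<Sum>k=1..N. v k * (\<Sum>d=1..N div k. u d))"
proof -
  have "(\<Sum>d=1..N. u d * (\<Sum>k=1..N div d. v k)) = (\<Sum>d=1..N. \<Sum>k\<in>{k\<in>{1..N}. d * k \<le> N}. u d * v k)"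
    unfolding sum_distrib_left
    by (intro sum.cong refl) (simp add: atLeastAtMost_div_eq[unfolded One_nat_def] mult.commute)
  also have "\<dots> = (\<Sum>k=1..N. \<Sum>d\<in>{d\<in>{1..N}. d * k \<le> N}. u d * v k)"
    by (rule sum.swap_restrict) auto
  also have "\<dots> = (\<Sum>k=1..N. v k * (\<Sum>d=1..N div k. u d))"
    unfolding sum_distrib_left
    by (intro sum.cong refl)
      (auto simp: atLeastAtMost_div_eq[unfolded One_nat_def] mult.commute)
  finally show ?thesis .
qed

lemma ln_fact_eq_sum_ln: "ln (fact n) = (\<Sum>k=1..n. ln (real k))"
proof (induction n)
  case (Suc n)
  then show ?case by (simp add: ln_mult del: of_nat_Suc)
qed simp

lemma sum_psi_div: "(\<Sum>k=1..n. psi (n div k)) = ln (fact n)"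
proof -
  have "ln (fact n) = (\<Sum>m=1..n. \<Sum>d | d dvd m. mangoldt d :: real)"
    unfolding ln_fact_eq_sum_ln by (intro sum.cong refl) (simp add: mangoldt_sum)
  also have "\<dots> = (\<Sum>d=1..n. \<Sum>k=1..n div d. mangoldt d)"
    by (rule sum_divisors_swap)
  also have "\<dots> = (\<Sum>d=1..n. mangoldt d * (\<Sum>k=1..n div d. 1))"
    by (simp add: mult.commute)
  also have "\<dots> = (\<Sum>k=1..n. psi (n div k))"
    by (subst sum_swap_div) (simp add: psi_def)
  finally show ?thesis ..
qed

text \<open>The indicator f is completely multiplicative, so multiplying ln = 1 * Lambda by f gives
  f ln = f * (f Lambda), in which only prime powers of the class occur.\<close>

lemma sum_gen_ind_ln:
  "(\<Sum>n=1..N. gen_ind P n * ln n) = (\<Sum>m=1..N. gen_ind P m * gen_psi P (N div m))"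
proof -
  have "(\<Sum>n=1..N. gen_ind P n * ln n) = (\<Sum>n=1..N. \<Sum>d | d dvd n. mangoldt d * gen_ind P n)"
  proof (intro sum.cong refl)
    fix n assume "n \<in> {1..N}"
    then show "gen_ind P n * ln n = (\<Sum>d | d dvd n. mangoldt d * gen_ind P n)"
      using mangoldt_sum[of n, where ?'a = real] by (simp flip: sum_distrib_right)
  qed
  also have "\<dots> = (\<Sum>d=1..N. (gen_ind P d * mangoldt d) * (\<Sum>k=1..N div d. gen_ind P k))"
    by (subst sum_divisors_swap) (simp add: gen_ind_mult sum_distrib_left mult_ac)
  also have "\<dots> = (\<Sum>m=1..N. gen_ind P m * gen_psi P (N div m))"
    unfolding gen_psi_def by (rule sum_swap_div)
  finally show ?thesis .
qed

text \<open>Stirling's formula with \<open>harm n\<close> in place of \<open>ln n\<close>, because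
  the terms \<open>N / (d * k)\<close> add up to harmonic numbers. From \<open>n\<close> to
  \<open>n + 1\<close> the error \<open>R\<close> grows by
  \<open>euler_mascheroni - (harm n - ln (n + 1))\<close>, which lies between 0 and
  \<open>1 / (n + 1)\<close>; these increments add up to at most \<open>harm n\<close>.\<close>

lemma ln_fact_harm_bounds:
  defines "R \<equiv> (\<lambda>n. ln (fact n) - real n * harm n + (1 + euler_mascheroni) * real n)"
  shows "0 \<le> R n" "R n \<le> harm n"
proof -
  have "0 \<le> R n \<and> R n \<le> harm n"
  proof (induction n)
    case (Suc n)
    have eq: "R (Suc n) = R n + (euler_mascheroni - (harm n - ln (real (Suc n))))"
      by (simp add: R_def ln_mult harm_Suc field_simps del: of_nat_Suc) (simp add: field_simps)
    have "harm n - ln (real (Suc n)) \<le> (euler_mascheroni :: real) \<and>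
          euler_mascheroni \<le> harm n - ln (real (Suc n)) + inverse (real (Suc n))"
    proof (cases n)
      case 0
      then show ?thesis using euler_mascheroni_pos euler_mascheroni_less_13_over_22
        by (simp add: harm_def)
    next
      case (Suc k)
      have 1: "1 / real (2 * (k + 1)) \<le> inverse (real (Suc n))"
        using Suc by (simp add: field_simps)
      have "1 / real (2 * (k + 2)) \<ge> 0" by simp
      then have 2: "harm (Suc k) - ln (real (k + 2)) \<le> (euler_mascheroni :: real)"
        using euler_mascheroni_lower[of k] by linarith
      show ?thesis
        using euler_mascheroni_upper[of k] 1 2 Suc
        by (simp add: add_ac)
    qed
    with eq Suc show ?case by (simp add: harm_Suc)
  qed (simp add: R_def harm_def)
  then show "0 \<le> R n" "R n \<le> harm n" by auto
qed

text \<open>Keeps the Stirling errors of all \<open>d\<close> together linear in \<open>N\<close>,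
  where the termwise bound \<open>harm N\<close> would lose a factor \<open>ln N\<close>. Exchanging
  the sums gives the sum of \<open>(N div k) / k\<close>, at most \<open>N\<close> times the sum of
  the inverse squares.\<close>

lemma sum_harm_div_le: "(\<Sum>d=1..N. harm (N div d)) \<le> 2 * real N"
proof -
  have sq: "(\<Sum>k=1..N. 1 / real k ^ 2) \<le> 2 - 1 / real N" for N
  proof (induction N)
    case (Suc N)
    show ?case
    proof (cases "N = 0")
      case False
      have "1 / real (Suc N) ^ 2 \<le> 1 / (real N * real (Suc N))"
        unfolding power2_eq_square using False by (intro divide_left_mono mult_right_mono) auto
      also have "\<dots> = 1 / real N - 1 / real (Suc N)"
        using False by (simp add: field_simps)
      finally have "1 / real (Suc N) ^ 2 \<le> 1 / real N - 1 / real (Suc N)" .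
      with Suc show ?thesis by simp
    qed simp
  qed simp
  have "(\<Sum>d=1..N. harm (N div d)) = (\<Sum>d=1..N. 1 * (\<Sum>k=1..N div d. inverse (real k)))"
    by (simp add: harm_def)
  also have "\<dots> = (\<Sum>k=1..N. inverse (real k) * real (N div k))"
    by (subst sum_swap_div) simp
  also have "\<dots> \<le> (\<Sum>k=1..N. inverse (real k) * (real N / real k))"
    by (intro sum_mono mult_left_mono) (auto simp: of_nat_div_le_of_nat)
  also have "\<dots> = real N * (\<Sum>k=1..N. 1 / real k ^ 2)"
    by (simp add: sum_distrib_left field_simps power2_eq_square)
  also have "\<dots> \<le> real N * 2"
    using order.trans[OF sq[of N], of 2] by (intro mult_left_mono) auto
  finally show ?thesis by (simp add: mult_ac)
qed

text \<open>For fixed \<open>d\<close> the inner sum over \<open>k\<close> is complete, so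
  Stirling's formula evaluates it. The shift \<open>1 + euler_mascheroni\<close> cancels the linear
  term of that formula. What is left is the Stirling error and the rounding error
  \<open>N / d - N div d\<close> times a harmonic number, each at most
  \<open>harm (N div d)\<close>.\<close>

lemma sum_gen_ind_psi_bound:
  "\<bar>\<Sum>m=1..N. gen_ind P m * (psi (N div m) - real N / real m + (1 + euler_mascheroni))\<bar> \<le> 4 * real N"
proof -
  let ?c = "1 + euler_mascheroni :: real"
  let ?b = "\<lambda>d. \<Sum>k=1..N div d. psi (N div (d * k)) - real N / real (d * k) + ?c"
  have b: "\<bar>?b d\<bar> \<le> 2 * harm (N div d)" if "d \<in> {1..N}" for d
  proof -
    define n where "n = N div d"
    have "?b d = (\<Sum>k=1..n. psi (n div k)) - real N / real d * harm n + ?c * real n"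
    proof -
      have "(\<Sum>k=1..n. real N / real (d * k)) = real N / real d * harm n"
        unfolding harm_def sum_distrib_left by (intro sum.cong) (auto simp: divide_simps)
      then show ?thesis
        by (simp add: n_def sum.distrib sum_subtractf div_mult2_eq)
    qed
    also have "\<dots> = (ln (fact n) - real n * harm n + ?c * real n) - (real N / real d - real n) * harm n"
      unfolding sum_psi_div by (simp add: algebra_simps)
    finally have eq: "?b d = \<dots>" .
    have "0 \<le> real N / real d - real n" "real N / real d - real n \<le> 1"
    proof -
      have "\<lfloor>real N / real d\<rfloor> = int n" by (simp add: n_def floor_divide_of_nat_eq)
      then show "0 \<le> real N / real d - real n" "real N / real d - real n \<le> 1" by linarith+
    qed
    then have "0 \<le> (real N / real d - real n) * harm n" "(real N / real d - real n) * harm n \<le> 1 * harm n"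
      by (intro mult_nonneg_nonneg mult_right_mono harm_nonneg; simp)+
    moreover have "\<bar>x - y\<bar> \<le> 2 * z" if "0 \<le> x" "x \<le> z" "0 \<le> y" "y \<le> z" for x y z :: real
      using that by linarith
    ultimately show ?thesis
      unfolding eq unfolding n_def[symmetric]
      using ln_fact_harm_bounds[of n] by (simp del: mult_1 add: mult_1)
  qed
  have "\<bar>\<Sum>m=1..N. gen_ind P m * (psi (N div m) - real N / real m + ?c)\<bar> =
        \<bar>\<Sum>d=1..N. gen_moebius (-P) d * ?b d\<bar>"
    by (subst sum_gen_ind_mult) simp
  also have "\<dots> \<le> (\<Sum>d=1..N. 1 * (2 * harm (N div d)))"
    by (intro order.trans[OF sum_abs] sum_mono) 
       (auto simp only: abs_mult intro!: mult_mono b abs_gen_moebius_le_1 harm_nonneg)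
  also have "\<dots> \<le> 4 * real N"
    using sum_harm_div_le[of N] by (simp flip: sum_distrib_left)
  finally show ?thesis .
qed

section \<open>Greedy balancing\<close>

primrec greedy_load :: "(nat \<Rightarrow> real) \<Rightarrow> nat \<Rightarrow> nat \<Rightarrow> nat \<Rightarrow> real" where
  "greedy_load w h 0 = (\<lambda>_. 0)"
| "greedy_load w h (Suc n) = (\<lambda>i. greedy_load w h n i +
     (if i = arg_min_on (greedy_load w h n) {..<h} then w (Suc n) else 0))"

text \<open>The class that receives index \<open>n\<close>, chosen by the loads before step
  \<open>n\<close>. Every index gets a class; composite ones will carry weight 0. At
  \<open>n = 0\<close> truncated subtraction makes this a choice among equal loads.\<close>

definition greedy_class :: "(nat \<Rightarrow> real) \<Rightarrow> nat \<Rightarrow> nat \<Rightarrow> nat" where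
  "greedy_class w h n = arg_min_on (greedy_load w h (n - 1)) {..<h}"

lemma greedy_load_eq_sum:
  "greedy_load w h n i = (\<Sum>k=1..n. of_bool (greedy_class w h k = i) * w k)"
  by (induction n) (auto simp: greedy_class_def)

context
  fixes w :: "nat \<Rightarrow> real" and h :: nat
  assumes w_nonneg: "\<And>n. w n \<ge> 0" and h: "h > 0"
begin

lemma greedy_class_less: "greedy_class w h n < h"
  using arg_min_if_finite(1)[of "{..<h}" "greedy_load w h (n - 1)"] h
  by (auto simp: greedy_class_def lessThan_empty_iff)

lemma greedy_class_least: "i < h \<Longrightarrow> greedy_load w h n (greedy_class w h (Suc n)) \<le> greedy_load w h n i"
  unfolding greedy_class_def using arg_min_least[of "{..<h}" i "greedy_load w h n"] by auto

lemma greedy_load_Suc: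
  "greedy_load w h (Suc n) i = greedy_load w h n i + of_bool (i = greedy_class w h (Suc n)) * w (Suc n)"
  by (simp add: greedy_class_def)

lemma sum_greedy_load: "(\<Sum>i<h. greedy_load w h n i) = (\<Sum>k=1..n. w k)"
proof -
  have "(\<Sum>i<h. greedy_load w h n i) = (\<Sum>k=1..n. \<Sum>i<h. of_bool (greedy_class w h k = i) * w k)"
    unfolding greedy_load_eq_sum by (rule sum.swap)
  also have "\<dots> = (\<Sum>k=1..n. w k)"
    using greedy_class_less by (intro sum.cong refl) (auto simp flip: sum_distrib_right)
  finally show ?thesis .
qed

definition balanced_at :: "real \<Rightarrow> nat \<Rightarrow> bool" where
  "balanced_at W n \<longleftrightarrow> (\<forall>i<h. \<forall>j<h. greedy_load w h n i - greedy_load w h n j \<le> W)"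

text \<open>The receiver was a lightest class, so it ends at most \<open>w (Suc n)\<close> above any
  other; no other difference grows.\<close>

lemma balanced_at_Suc:
  assumes "balanced_at W n" "w (Suc n) \<le> W"
  shows "balanced_at W (Suc n)"
  unfolding balanced_at_def
proof (intro allI impI)
  fix i j assume ij: "i < h" "j < h"
  have W: "W \<ge> 0" using assms(2) w_nonneg[of "Suc n"] by linarith
  show "greedy_load w h (Suc n) i - greedy_load w h (Suc n) j \<le> W"
    unfolding greedy_load_Suc
    using assms ij greedy_class_least[of j n] w_nonneg[of "Suc n"] W
    unfolding balanced_at_def by (cases "i = j") (fastforce simp: of_bool_def)+
qed

lemma balanced_at_mono:
  assumes "balanced_at W m" "m \<le> n" "\<And>k. m < k \<Longrightarrow> k \<le> n \<Longrightarrow> w k \<le> W"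
  shows "balanced_at W n"
  using assms(2,1,3) by (induction rule: dec_induct) (auto intro: balanced_at_Suc)

text \<open>As long as the spread exceeds every new weight, the fullest class receives nothing.\<close>

lemma balanced_at_catch_up:
  assumes bal: "balanced_at U a" and "a \<le> b"
    and sum: "(\<Sum>k\<in>{a<..b}. w k) > real h * U"
    and W: "\<And>k. a < k \<Longrightarrow> k \<le> b \<Longrightarrow> w k \<le> W"
  shows "balanced_at W b"
proof (rule ccontr)
  assume contra: "\<not> balanced_at W b"
  have unbal: "\<not> balanced_at W n" if "a \<le> n" "n \<le> b" for n
    using contra balanced_at_mono[of W n b] that W by force
  \<comment> \<open>\<open>M\<close> is the highest load at time \<open>a\<close>. While the classes
    stay unbalanced no load passes \<open>M\<close>, so the room below \<open>M\<close> at time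
    \<open>a\<close>, at most \<open>h * U\<close>, bounds all the weight handed out until
    \<open>b\<close>.\<close>
  define M where "M = Max (greedy_load w h a ` {..<h})"
  have ne: "greedy_load w h a ` {..<h} \<noteq> {}" using h by (simp add: lessThan_empty_iff)
  have M: "greedy_load w h a i \<le> M" if "i < h" for i
    unfolding M_def using that by (intro Max_ge) auto
  obtain i0 where i0: "i0 < h" "greedy_load w h a i0 = M"
    using Max_in[OF _ ne] unfolding M_def by auto
  have le_M: "\<forall>i<h. greedy_load w h n i \<le> M" if "a \<le> n" "n \<le> b" for n
    using that
  proof (induction n rule: dec_induct)
    case (step n)
    then have IH: "\<forall>i<h. greedy_load w h n i \<le> M" by simp
    obtain i j where ij: "i < h" "j < h" "greedy_load w h n i - greedy_load w h n j > W"
      using unbal[of n] step.hyps step.prems unfolding balanced_at_def by (force simp: not_le)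
    \<comment> \<open>The receiver is no heavier than class \<open>j\<close>, which lies more than
      \<open>W\<close> below class \<open>i\<close>; even with the new weight it stays below the
      load of \<open>i\<close>.\<close>
    have "greedy_load w h n (greedy_class w h (Suc n)) + w (Suc n) \<le> greedy_load w h n j + W"
      using greedy_class_least[OF ij(2), of n] W[of "Suc n"] step.hyps step.prems by fastforce
    also have "\<dots> \<le> M" using IH ij by fastforce
    finally show ?case using IH by (auto simp: greedy_load_Suc of_bool_def simp del: greedy_load.simps)
  qed (use M in auto)
  have "(\<Sum>k=1..b. w k) \<le> (\<Sum>i<h. M)"
    unfolding sum_greedy_load[symmetric] using le_M[of b] \<open>a \<le> b\<close> by (intro sum_mono) auto
  moreover have "(\<Sum>i<h. M - U) \<le> (\<Sum>k=1..a. w k)"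
    unfolding sum_greedy_load[symmetric] using bal i0 unfolding balanced_at_def
    by (intro sum_mono) (auto simp: algebra_simps)
  moreover have "(\<Sum>k=1..b. w k) = (\<Sum>k=1..a. w k) + (\<Sum>k\<in>{a<..b}. w k)"
    using \<open>a \<le> b\<close> by (subst sum.union_disjoint[symmetric]) (auto intro!: sum.cong)
  ultimately show False using sum by (simp add: algebra_simps)
qed

lemma balanced_at_bound:
  assumes "\<And>k. w k \<le> W"
  shows "balanced_at W n"
proof -
  have "balanced_at W 0" using assms[of 0] w_nonneg[of 0] by (simp add: balanced_at_def)
  then show ?thesis by (rule balanced_at_mono) (use assms in auto)
qed

end

section \<open>Euler products and the balanced distribution of the primes\<close>

definition prime_weight :: "real \<Rightarrow> nat \<Rightarrow> real" where
  "prime_weight s k = (if prime k then - ln (1 - real k powr - s) else 0)"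

lemma prime_powr_less_1: "prime p \<Longrightarrow> s > 0 \<Longrightarrow> real p powr - s < 1"
  using prime_gt_1_nat[of p] by (intro powr_less_one) auto

lemma prime_weight_nonneg: "s > 0 \<Longrightarrow> prime_weight s k \<ge> 0"
  using prime_powr_less_1[of k s] by (auto simp: prime_weight_def)

lemma exp_prime_weight:
  "prime p \<Longrightarrow> s > 0 \<Longrightarrow> exp (prime_weight s p) = 1 / (1 - real p powr - s)"
  using prime_powr_less_1[of p s] by (simp add: prime_weight_def exp_minus inverse_eq_divide)

text \<open>Inserting a prime \<open>p\<close> writes each \<open>n\<close> uniquely as
  \<open>p ^ k * m\<close> with \<open>m\<close> free of \<open>p\<close>, so a geometric series
  multiplies the previous product. As \<open>Q\<close> is finite, every \<open>s > 0\<close> is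
  allowed; \<open>s = 1\<close> serves the lower bound on the total prime weight.\<close>

lemma has_sum_euler_product_finite:
  assumes "finite Q" "\<And>p. p \<in> Q \<Longrightarrow> prime p" "s > 0"
  shows "((\<lambda>n. real n powr - s) has_sum (\<Prod>p\<in>Q. 1 / (1 - real p powr - s))) 
     {n. n > 0 \<and> prime_factors n \<subseteq> Q}"
  using assms(1,2)
proof induction
  case empty
  have "{n::nat. n > 0 \<and> prime_factors n \<subseteq> {}} = {1}"
    by (auto simp: prime_factorization_empty_iff)
  then show ?case using has_sum_finite[of "{1::nat}" "\<lambda>n. real n powr - s"] by simp
next
  case (insert p Q)
  let ?G = "\<lambda>Q. {n::nat. n > 0 \<and> prime_factors n \<subseteq> Q}"
  let ?z = "real p powr - s"
  let ?E = "\<Prod>p\<in>Q. 1 / (1 - real p powr - s)"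
  have p: "prime p" using insert.prems by simp
  have IH: "((\<lambda>n. real n powr - s) has_sum ?E) (?G Q)" using insert by simp
  have geo: "((\<lambda>k. ?z ^ k) has_sum (1 / (1 - ?z))) UNIV"
    using prime_powr_less_1[OF p \<open>s > 0\<close>] by (intro sums_nonneg_imp_has_sum geometric_sums) auto
  have inner: "((\<lambda>m. ?z ^ fst (k, m) * real (snd (k, m)) powr - s) has_sum (?z ^ k * ?E)) (?G Q)" for k
    using has_sum_cmult_right[OF IH, of "?z ^ k"] by simp
  have outer: "((\<lambda>k. ?z ^ k * ?E) has_sum (1 / (1 - ?z) * ?E)) UNIV"
    by (rule has_sum_cmult_left[OF geo])
  have "((\<lambda>x. ?z ^ fst x * real (snd x) powr - s) has_sum (1 / (1 - ?z) * ?E)) (UNIV \<times> ?G Q)"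
    by (rule has_sum_SigmaI[OF inner outer summable_on_SigmaI[OF inner]])
       (use outer in \<open>auto simp: summable_on_def\<close>)
  also have "?this \<longleftrightarrow> ((\<lambda>n. real n powr - s) has_sum (1 / (1 - ?z) * ?E)) (?G (insert p Q))"
  proof (rule has_sum_reindex_bij_witness[of _ "\<lambda>n. (multiplicity p n, n div p ^ multiplicity p n)" "\<lambda>(k, m). p ^ k * m"])
    fix x :: "nat \<times> nat" assume x: "x \<in> UNIV \<times> ?G Q"
    obtain k m :: nat where [simp]: "x = (k, m)" by (cases x)
    have m: "m > 0" "prime_factors m \<subseteq> Q" using x by auto
    have "\<not> p dvd m" using m insert.hyps p by (auto simp: prime_factors_dvd)
    then have "multiplicity p (p ^ k * m) = k"
      using p by (intro multiplicity_decomposeI[of _ p k m]) auto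
    then show "(multiplicity p (case x of (k, m) \<Rightarrow> p ^ k * m),
         (case x of (k, m) \<Rightarrow> p ^ k * m) div p ^ multiplicity p (case x of (k, m) \<Rightarrow> p ^ k * m)) = x"
      using p by (simp add: prime_gt_0_nat)
    have "prime_factors (p ^ k * m) \<subseteq> insert p Q"
    proof
      fix q assume "q \<in> prime_factors (p ^ k * m)"
      then have q: "prime q" "q dvd p ^ k * m" by (auto simp: prime_factors_dvd)
      then have "q dvd p \<or> q dvd m" using prime_dvd_mult_iff prime_dvd_power by blast
      then show "q \<in> insert p Q"
      proof
        assume "q dvd p"
        then show ?thesis using q p primes_dvd_imp_eq by blast
      next
        assume "q dvd m"
        then have "q \<in> prime_factors m" using q m by (simp add: prime_factors_dvd)
        then show ?thesis using m by blast
      qed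
    qed
    then show "(case x of (k, m) \<Rightarrow> p ^ k * m) \<in> ?G (insert p Q)"
      using m p by (simp add: prime_gt_0_nat)
    have "?z ^ k = real (p ^ k) powr - s"
      using p by (simp add: prime_gt_0_nat powr_realpow[symmetric] powr_powr mult.commute)
    then show "real (case x of (k, m) \<Rightarrow> p ^ k * m) powr - s = ?z ^ fst x * real (snd x) powr - s"
      by (simp add: powr_mult)
  next
    fix n assume n: "n \<in> ?G (insert p Q)"
    obtain y where y: "n = p ^ multiplicity p n * y" "\<not> p dvd y"
      using multiplicity_decompose'[of n p] n p by (metis mem_Collect_eq not_prime_unit not_gr_zero)
    have "n div p ^ multiplicity p n = y"
      using y(1) p by (metis nonzero_mult_div_cancel_left not_prime_0 power_not_zero)
    moreover have "y > 0" using y n by (auto intro: Nat.gr0I)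
    moreover have "prime_factors y \<subseteq> prime_factors n"
      using n y(1) by (intro dvd_prime_factors) (auto simp: dvd_def mult.commute)
    moreover have "p \<notin> prime_factors y" using y(2) by (auto simp: prime_factors_dvd)
    ultimately show "(multiplicity p n, n div p ^ multiplicity p n) \<in> UNIV \<times> ?G Q"
      using n by auto
    show "(case (multiplicity p n, n div p ^ multiplicity p n) of (k, m) \<Rightarrow> p ^ k * m) = n"
      by (simp add: multiplicity_dvd)
  qed simp
  finally show ?case using insert.hyps by simp
qed

lemma euler_product_eq_exp:
  assumes "s > 0"
  shows "(\<Prod>p\<in>{p\<in>{1..N}. prime p \<and> p \<in> P}. 1 / (1 - real p powr - s)) =
     exp (\<Sum>k=1..N. of_bool (k \<in> P) * prime_weight s k)"
proof -
  have "(\<Sum>k=1..N. of_bool (k \<in> P) * prime_weight s k) = (\<Sum>p\<in>{p\<in>{1..N}. prime p \<and> p \<in> P}. prime_weight s p)"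
    by (rule sum.mono_neutral_cong_right) (auto simp: prime_weight_def)
  then show ?thesis using assms by (simp add: exp_sum exp_prime_weight)
qed

text \<open>All prime factors of an \<open>n \<le> N\<close> are at most \<open>N\<close>, so the
  truncated sum is part of the expansion of the truncated Euler product.\<close>

lemma sum_gen_ind_le_exp:
  assumes "s > 0"
  shows "(\<Sum>n=1..N. gen_ind P n * real n powr - s) \<le> exp (\<Sum>k=1..N. of_bool (k \<in> P) * prime_weight s k)"
proof -
  let ?Q = "{p\<in>{1..N}. prime p \<and> p \<in> P}"
  have "(\<Sum>n=1..N. gen_ind P n * real n powr - s) = (\<Sum>n\<in>{n\<in>{1..N}. prime_factors n \<subseteq> P}. real n powr - s)"
    by (rule sum.mono_neutral_cong_right) (auto simp: gen_ind_def)
  also have "\<dots> \<le> (\<Prod>p\<in>?Q. 1 / (1 - real p powr - s))"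
  proof (rule finite_sum_le_has_sum[OF has_sum_euler_product_finite])
    show "{n \<in> {1..N}. prime_factors n \<subseteq> P} \<subseteq> {n. 0 < n \<and> prime_factors n \<subseteq> ?Q}"
    proof safe
      fix n p assume "n \<in> {1..N}" "prime_factors n \<subseteq> P" "p \<in> prime_factors n"
      then show "p \<in> {1..N}" "prime p" "p \<in> P"
        using prime_factors_dvd[of n] dvd_imp_le[of p n] prime_ge_1_nat[of p] by (auto simp: in_mono)
    qed auto
  qed (use assms in auto)
  finally show ?thesis using euler_product_eq_exp[OF assms] by simp
qed

lemma summable_gen_ind:
  assumes "s > 1"
  shows "summable (\<lambda>n. gen_ind P n * real n powr - s)"
  by (rule summable_comparison_test[of _ "\<lambda>n. real n powr - s"])
     (use assms in \<open>auto simp: summable_real_powr_iff abs_mult intro!: mult_left_le_one_le\<close>)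

definition gen_series :: "nat set \<Rightarrow> real \<Rightarrow> real" where
  "gen_series P s = (\<Sum>n. gen_ind P n * real n powr - s)"

text \<open>The product over the primes up to \<open>N\<close> is caught between the sum over
  \<open>n \<le> N\<close> and the whole series.\<close>

lemma euler_product_tendsto:
  assumes s: "s > 1"
  shows "(\<lambda>N. exp (\<Sum>k=1..N. of_bool (k \<in> P) * prime_weight s k)) \<longlonglongrightarrow> gen_series P s"
proof (rule tendsto_sandwich)
  show "eventually (\<lambda>N. (\<Sum>n\<le>N. gen_ind P n * real n powr - s) \<le>
     exp (\<Sum>k=1..N. of_bool (k \<in> P) * prime_weight s k)) sequentially"
  proof (intro always_eventually allI)
    fix N
    have "(\<Sum>n\<le>N. gen_ind P n * real n powr - s) = (\<Sum>n=1..N. gen_ind P n * real n powr - s)"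
      by (rule sum.mono_neutral_right) (auto simp: not_le)
    then show "(\<Sum>n\<le>N. gen_ind P n * real n powr - s) \<le> exp (\<Sum>k=1..N. of_bool (k \<in> P) * prime_weight s k)"
      using sum_gen_ind_le_exp[of s] s by simp
  qed
  show "(\<lambda>N. \<Sum>n\<le>N. gen_ind P n * real n powr - s) \<longlonglongrightarrow> gen_series P s"
    using summable_LIMSEQ'[OF summable_gen_ind[OF s]] unfolding gen_series_def .
  show "eventually (\<lambda>N. exp (\<Sum>k=1..N. of_bool (k \<in> P) * prime_weight s k) \<le> gen_series P s) sequentially"
  proof (intro always_eventually allI)
    fix N
    let ?Q = "{p\<in>{1..N}. prime p \<and> p \<in> P}"
    have all: "((\<lambda>n. gen_ind P n * real n powr - s) has_sum gen_series P s) UNIV"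
      unfolding gen_series_def by (intro sums_nonneg_imp_has_sum summable_sums summable_gen_ind s) auto
    have "((\<lambda>n. real n powr - s) has_sum (\<Prod>p\<in>?Q. 1 / (1 - real p powr - s))) {n. 0 < n \<and> prime_factors n \<subseteq> ?Q}"
      using s by (intro has_sum_euler_product_finite) auto
    also have "?this \<longleftrightarrow> ((\<lambda>n. gen_ind P n * real n powr - s) has_sum (\<Prod>p\<in>?Q. 1 / (1 - real p powr - s))) {n. 0 < n \<and> prime_factors n \<subseteq> ?Q}"
      by (intro has_sum_cong) (auto simp: gen_ind_def)
    finally have "(\<Prod>p\<in>?Q. 1 / (1 - real p powr - s)) \<le> gen_series P s"
      by (rule has_sum_mono2[OF _ all]) auto
    then show "exp (\<Sum>k=1..N. of_bool (k \<in> P) * prime_weight s k) \<le> gen_series P s"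
      using euler_product_eq_exp[of s N P] s by simp
  qed
qed auto

section \<open>Elementary bounds of Mertens type for the total prime weight\<close>

lemma sum_prime_weight_lower: "ln (ln (real N + 1)) \<le> (\<Sum>k=1..N. prime_weight 1 k)" if "N > 0"
proof -
  \<comment> \<open>The full series diverges at \<open>s = 1\<close>, yet the finite Euler product
    dominates the harmonic sum up to \<open>N\<close>.\<close>
  have "ln (real N + 1) \<le> harm N" by (rule harm_ge_ln)
  also have "\<dots> = (\<Sum>n=1..N. gen_ind UNIV n * real n powr - 1)"
    unfolding harm_def by (intro sum.cong) (auto simp: gen_ind_def powr_minus)
  also have "\<dots> \<le> exp (\<Sum>k=1..N. prime_weight 1 k)"
    using sum_gen_ind_le_exp[of 1 UNIV N] by simp
  finally have "ln (ln (real N + 1)) \<le> ln (exp (\<Sum>k=1..N. prime_weight 1 k))"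
    using that by (subst ln_le_cancel_iff) auto
  then show ?thesis by simp
qed

lemma prime_weight_1: "prime k \<Longrightarrow> prime_weight 1 k = ln (real k / (real k - 1))"
proof -
  assume k: "prime k"
  then have "real k > 1" using prime_gt_1_nat[of k] by simp
  then have "- ln (1 - 1 / real k) = ln (inverse (1 - 1 / real k))"
    by (subst ln_inverse) (auto simp: field_simps)
  also have "inverse (1 - 1 / real k) = real k / (real k - 1)"
    using \<open>real k > 1\<close> by (simp add: field_simps)
  finally show ?thesis using k by (simp add: prime_weight_def powr_minus inverse_eq_divide)
qed

text \<open>Every odd number is treated as if it were prime. For odd \<open>k = t + 2\<close>, the
  inequality \<open>t * (t + 2) \<le> (t + 1) * (t + 1)\<close> gives
  \<open>ln (k / (k - 1)) \<le> (ln k - ln (k - 2)) / 2\<close>, and this telescopes.\<close>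

lemma sum_prime_weight_odd:
  "(\<Sum>k=1..2 * m + 3. prime_weight 1 k) \<le> ln 2 + ln (2 * real m + 3) / 2"
proof (induction m)
  case 0
  have "(\<Sum>k=1..3. prime_weight 1 k) = prime_weight 1 2 + prime_weight 1 3"
    by (simp add: numeral_eq_Suc prime_weight_def)
  also have "\<dots> = ln 2 + ln (3 / 2)"
  proof -
    have "{2..<3} = {2::nat}" by auto
    then have "prime (3::nat)" by (simp add: prime_nat_iff')
    then show ?thesis by (simp add: prime_weight_1)
  qed
  also have "ln (3 / 2 :: real) \<le> ln 3 / 2"
  proof -
    have "ln ((3 / 2) ^ 2 :: real) \<le> ln 3" by (subst ln_le_cancel_iff) (auto simp: power2_eq_square)
    then show ?thesis by (simp add: ln_realpow)
  qed
  finally show ?case by simp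
next
  case (Suc m)
  have "\<not> prime (2 * m + 4)" using prime_odd_nat[of "2 * m + 4"] by auto
  then have "prime_weight 1 (2 * m + 4) = 0" by (simp add: prime_weight_def)
  moreover have "prime_weight 1 (2 * m + 5) \<le> ln (2 * real m + 5) / 2 - ln (2 * real m + 3) / 2"
  proof (cases "prime (2 * m + 5)")
    case True
    define t where "t = 2 * real m + 3"
    have t: "t > 0" by (simp add: t_def add_nonneg_pos)
    have "ln (t * (t + 2)) \<le> ln ((t + 1) * (t + 1))"
      using t by (subst ln_le_cancel_iff) (auto simp: algebra_simps add_pos_pos)
    then have "ln t + ln (t + 2) \<le> ln (t + 1) + ln (t + 1)"
      using t by (simp add: ln_mult)
    moreover have "prime_weight 1 (2 * m + 5) = ln (t + 2) - ln (t + 1)"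
    proof -
      have "prime_weight 1 (2 * m + 5) = ln ((t + 2) / (t + 1))"
        using True by (simp add: prime_weight_1 t_def add_ac)
      then show ?thesis using t by (simp add: ln_div)
    qed
    moreover have "2 * real m + 5 = t + 2" by (simp add: t_def)
    ultimately show ?thesis unfolding t_def[symmetric] by (simp only:)
  qed (simp add: prime_weight_def)
  moreover have "(\<Sum>k=1..2 * Suc m + 3. prime_weight 1 k) = (\<Sum>k=1..2 * m + 3. prime_weight 1 k) + prime_weight 1 (2 * m + 4) + prime_weight 1 (2 * m + 5)"
    by (simp add: numeral_eq_Suc)
  ultimately show ?case using Suc by (simp add: algebra_simps)
qed

lemma sum_prime_weight_upper: "(\<Sum>k=1..N. prime_weight 1 k) \<le> ln 2 + ln (real N + 3) / 2"
proof -
  have "(\<Sum>k=1..N. prime_weight 1 k) \<le> (\<Sum>k=1..2 * (N div 2) + 3. prime_weight 1 k)"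
    by (rule sum_mono2) (auto intro!: prime_weight_nonneg)
  also have "\<dots> \<le> ln 2 + ln (2 * real (N div 2) + 3) / 2" by (rule sum_prime_weight_odd)
  also have "\<dots> \<le> ln 2 + ln (real N + 3) / 2"
  proof -
    have "2 * real (N div 2) \<le> real N" by linarith
    then show ?thesis by simp
  qed
  finally show ?thesis .
qed

lemma prime_weight_1_le:
  assumes "a > 0" "k > a"
  shows "prime_weight 1 k \<le> 1 / real a"
proof (cases "prime k")
  case True
  have "ln (real k / (real k - 1)) \<le> real k / (real k - 1) - 1"
    using assms by (intro ln_le_minus_one) auto
  also have "\<dots> = 1 / (real k - 1)" using assms by (simp add: field_simps)
  also have "\<dots> \<le> 1 / real a" using assms by (intro divide_left_mono) auto
  finally show ?thesis using True by (simp add: prime_weight_1)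
qed (simp add: prime_weight_def)

lemma prime_weight_1_le_1: "prime_weight 1 k \<le> 1"
  using prime_weight_1_le[of 1 k] by (cases "k > 1") (auto simp: prime_weight_def prime_gt_1_nat not_less dest: prime_gt_1_nat)

text \<open>Weights beyond \<open>a n\<close>, about \<open>K * ln n\<close>, are at most
  \<open>1 / (K * ln n)\<close>, and \<open>K = 2 / e\<close> turns a spread of this size into
  \<open>e / 2\<close> after multiplication by \<open>ln n\<close>. The spread at \<open>a n\<close>
  is at most 1, so the catch-up is complete if the weight between \<open>a n\<close> and
  \<open>n\<close> exceeds \<open>h\<close>.\<close>

lemma greedy_prime_balance:
  assumes "h > 0" "i < h" "j < h"
  shows "(\<lambda>n. (greedy_load (prime_weight 1) h n i - greedy_load (prime_weight 1) h n j) * ln (real n)) \<longlonglongrightarrow> 0"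
proof (rule tendstoI)
  fix e :: real assume "e > 0"
  define K where "K = 2 / e"
  have "K > 0" using \<open>e > 0\<close> by (simp add: K_def)
  define a where "a = (\<lambda>n::nat. nat \<lceil>K * ln (real n)\<rceil>)"
  \<comment> \<open>The lower bound for the weight up to \<open>n\<close> minus the upper bound for
    the weight up to \<open>a n\<close>; it grows like \<open>ln (ln n) / 2\<close>. The 4 is the 3
    of the upper bound plus 1 for rounding up in \<open>a n\<close>.\<close>
  have "eventually (\<lambda>n::nat. ln (ln (real n + 1)) - (ln 2 + ln (K * ln (real n) + 4) / 2) > real h) at_top"
    using \<open>K > 0\<close> by real_asymp
  moreover have "eventually (\<lambda>n::nat. K * ln (real n) + 1 \<le> real n) at_top"
    using \<open>K > 0\<close> by real_asymp
  ultimately show "eventually (\<lambda>n. dist ((greedy_load (prime_weight 1) h n i - greedy_load (prime_weight 1) h n j) * ln (real n)) 0 < e) at_top"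
    using eventually_gt_at_top[of 1]
  proof eventually_elim
    case (elim n)
    let ?l = "greedy_load (prime_weight 1) h n"
    have ln: "ln (real n) > 0" using elim by simp
    have a: "K * ln (real n) \<le> real (a n)" "real (a n) \<le> K * ln (real n) + 1"
    proof -
      have "real (a n) = of_int \<lceil>K * ln (real n)\<rceil>"
        unfolding a_def using \<open>K > 0\<close> ln by (intro of_nat_nat) (simp add: zero_le_ceiling less_le_trans[of "-1" 0])
      then show "K * ln (real n) \<le> real (a n)" "real (a n) \<le> K * ln (real n) + 1"
        by linarith+
    qed
    have a0: "real (a n) > 0" using a(1) \<open>K > 0\<close> ln by (smt (verit) mult_pos_pos)
    have an: "a n \<le> n" using a elim by linarith
    have "(\<Sum>k=1..n. prime_weight 1 k) = (\<Sum>k=1..a n. prime_weight 1 k) + (\<Sum>k\<in>{a n<..n}. prime_weight 1 k)"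
      using an by (subst sum.union_disjoint[symmetric]) (auto intro!: sum.cong)
    moreover have "(\<Sum>k=1..a n. prime_weight 1 k) \<le> ln 2 + ln (K * ln (real n) + 4) / 2"
    proof -
      have "ln (real (a n) + 3) \<le> ln (K * ln (real n) + 4)"
        using a a0 by (subst ln_le_cancel_iff) linarith+
      then show ?thesis using sum_prime_weight_upper[of "a n"] by linarith
    qed
    ultimately have "(\<Sum>k\<in>{a n<..n}. prime_weight 1 k) > real h * 1"
      using sum_prime_weight_lower[of n] elim by simp
    moreover have "balanced_at (prime_weight 1) h 1 (a n)"
      by (rule balanced_at_bound) (auto simp: prime_weight_nonneg prime_weight_1_le_1 assms)
    ultimately have "balanced_at (prime_weight 1) h (1 / real (a n)) n"
      using an a0 assms(1) prime_weight_nonneg[of 1] prime_weight_1_le[of "a n"]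
      by - (rule balanced_at_catch_up[where a = "a n" and U = 1]; simp)
    then have "?l i - ?l j \<le> 1 / real (a n)" "?l j - ?l i \<le> 1 / real (a n)"
      using assms by (auto simp: balanced_at_def prime_weight_nonneg)
    then have "\<bar>?l i - ?l j\<bar> \<le> 1 / real (a n)" by linarith
    also have "\<dots> \<le> 1 / (K * ln (real n))"
      using a a0 \<open>K > 0\<close> ln by (intro divide_left_mono) auto
    finally have "\<bar>?l i - ?l j\<bar> * ln (real n) \<le> 1 / K"
      using \<open>K > 0\<close> ln by (simp add: field_simps)
    also have "1 / K < e" using \<open>e > 0\<close> by (simp add: K_def)
    finally show ?case using ln by (simp add: abs_mult)
  qed
qed

section \<open>Karamata's Tauberian theorem\<close>

definition gamma_kernel :: "real \<Rightarrow> real \<Rightarrow> real" where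
  "gamma_kernel s t = indicator {0..} t * (t powr (s - 1) / exp t)"

lemma gamma_kernel_nonneg [simp]: "gamma_kernel s t \<ge> 0"
  by (simp add: gamma_kernel_def)

lemma gamma_kernel_measurable [measurable]: "gamma_kernel s \<in> borel_measurable borel"
  unfolding gamma_kernel_def[abs_def] by measurable

lemma has_bochner_integral_gamma_kernel:
  assumes "s > 0"
  shows "has_bochner_integral lborel (gamma_kernel s) (Gamma s)"
proof (rule has_bochner_integral_nn_integral)
  show "(\<integral>\<^sup>+t. ennreal (gamma_kernel s t) \<partial>lborel) = ennreal (Gamma s)"
    using Gamma_conv_nn_integral_real[OF assms] by (simp add: gamma_kernel_def)
qed (use assms in \<open>auto intro: less_imp_le Gamma_real_pos\<close>)

text \<open>Substitution of \<open>(k + 1) * t\<close> for \<open>t\<close> in the Gamma integral;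
  these moments settle the polynomial case of Karamata's theorem.\<close>

lemma has_bochner_integral_gamma_kernel_power:
  assumes "s > 0"
  shows "has_bochner_integral lborel (\<lambda>t. gamma_kernel s t * exp (-t) ^ k) (Gamma s / real (Suc k) powr s)"
proof -
  let ?c = "real (Suc k)"
  have eq: "gamma_kernel s (0 + ?c * t) = ?c powr (s - 1) * (gamma_kernel s t * exp (-t) ^ k)" for t
  proof (cases "t \<ge> 0")
    case True
    have "exp (?c * t) = exp t * exp t ^ k"
      by (simp add: ring_distribs exp_add exp_of_nat_mult)
    then show ?thesis using True
      by (simp add: gamma_kernel_def powr_mult exp_minus field_simps del: of_nat_Suc)
  qed (auto simp: gamma_kernel_def zero_le_mult_iff)
  have "integrable lborel (\<lambda>t. gamma_kernel s (0 + ?c * t))"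
    using has_bochner_integral_gamma_kernel[OF assms]
    by (subst lborel_integrable_real_affine_iff) (auto simp: has_bochner_integral_iff)
  then have 1: "integrable lborel (\<lambda>t. gamma_kernel s t * exp (-t) ^ k)"
    unfolding eq by (simp del: of_nat_Suc)
  have "Gamma s = (\<integral>t. gamma_kernel s t \<partial>lborel)"
    using has_bochner_integral_gamma_kernel[OF assms] by (simp add: has_bochner_integral_iff)
  also have "\<dots> = ?c * (\<integral>t. gamma_kernel s (0 + ?c * t) \<partial>lborel)"
    by (subst lborel_integral_real_affine[where c = ?c and t = 0]) auto
  also have "\<dots> = ?c * ?c powr (s - 1) * (\<integral>t. gamma_kernel s t * exp (-t) ^ k \<partial>lborel)"
    unfolding eq by simp
  also have "?c * ?c powr (s - 1) = ?c powr s"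
    using powr_add[of ?c 1 "s - 1"] by (simp del: of_nat_Suc)
  finally show ?thesis
    using 1 by (simp add: has_bochner_integral_iff field_simps del: of_nat_Suc)
qed

text \<open>The expectation of \<open>g (exp (-T))\<close> for a Gamma distributed \<open>T\<close>
  of shape \<open>s\<close>, the limit functional in Karamata's theorem.\<close>

definition gamma_mean :: "real \<Rightarrow> (real \<Rightarrow> real) \<Rightarrow> real" where
  "gamma_mean s g = (\<integral>t. gamma_kernel s t * g (exp (-t)) \<partial>lborel) / Gamma s"

lemma integrable_gamma_kernel_mult:
  assumes "s > 0" "g \<in> borel_measurable borel" "\<And>y. 0 \<le> y \<Longrightarrow> y \<le> 1 \<Longrightarrow> \<bar>g y\<bar> \<le> B"
  shows "integrable lborel (\<lambda>t. gamma_kernel s t * g (exp (-t)))"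
proof (rule Bochner_Integration.integrable_bound)
  show "integrable lborel (\<lambda>t. gamma_kernel s t * B)"
    using has_bochner_integral_gamma_kernel[OF assms(1)] by (auto simp: has_bochner_integral_iff)
  show "(\<lambda>t. gamma_kernel s t * g (exp (-t))) \<in> borel_measurable lborel"
    using assms(2) by measurable
  show "AE t in lborel. norm (gamma_kernel s t * g (exp (-t))) \<le> norm (gamma_kernel s t * B)"
  proof (rule AE_I2)
    fix t :: real
    show "norm (gamma_kernel s t * g (exp (-t))) \<le> norm (gamma_kernel s t * B)"
    proof (cases "t \<ge> 0")
      case True
      then have "\<bar>g (exp (-t))\<bar> \<le> \<bar>B\<bar>" using assms(3)[of "exp (-t)"] by simp
      then show ?thesis by (simp add: abs_mult mult_left_mono)
    qed (simp add: gamma_kernel_def)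
  qed
qed

lemma gamma_mean_diff_le:
  assumes "s > 0" "continuous_on UNIV g" "continuous_on UNIV p"
    and close: "\<And>y. 0 \<le> y \<Longrightarrow> y \<le> 1 \<Longrightarrow> \<bar>g y - p y\<bar> \<le> e"
  shows "\<bar>gamma_mean s g - gamma_mean s p\<bar> \<le> e"
proof -
  have int: "integrable lborel (\<lambda>t. gamma_kernel s t * q (exp (-t)))" if "continuous_on UNIV q" for q :: "real \<Rightarrow> real"
  proof -
    have "continuous_on {0..1} q" using that continuous_on_subset by blast
    then have "bounded (q ` {0..1})" by (intro compact_imp_bounded compact_continuous_image) auto
    then obtain B where "\<And>y. 0 \<le> y \<Longrightarrow> y \<le> 1 \<Longrightarrow> \<bar>q y\<bar> \<le> B"
      unfolding bounded_iff by (metis atLeastAtMost_iff image_eqI real_norm_def)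
    then show ?thesis
      using assms(1) that by (intro integrable_gamma_kernel_mult[where B = B]) 
        (auto intro: borel_measurable_continuous_onI)
  qed
  have G: "Gamma s > 0" using assms(1) by (rule Gamma_real_pos)
  have "\<bar>gamma_mean s g - gamma_mean s p\<bar> =
     \<bar>\<integral>t. gamma_kernel s t * g (exp (-t)) - gamma_kernel s t * p (exp (-t)) \<partial>lborel\<bar> / Gamma s"
    using G by (subst Bochner_Integration.integral_diff[OF int int])
      (auto simp: assms gamma_mean_def abs_divide simp flip: diff_divide_distrib)
  also have "\<dots> \<le> (\<integral>t. gamma_kernel s t * e \<partial>lborel) / Gamma s"
  proof (intro divide_right_mono integral_abs_bound_integral)
    show "integrable lborel (\<lambda>t. gamma_kernel s t * g (exp (-t)) - gamma_kernel s t * p (exp (-t)))"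
      by (intro Bochner_Integration.integrable_diff int assms)
    show "integrable lborel (\<lambda>t. gamma_kernel s t * e)"
      using has_bochner_integral_gamma_kernel[OF assms(1)] by (auto simp: has_bochner_integral_iff)
    fix t :: real
    show "\<bar>gamma_kernel s t * g (exp (-t)) - gamma_kernel s t * p (exp (-t))\<bar> \<le> gamma_kernel s t * e"
    proof (cases "t \<ge> 0")
      case True
      then show ?thesis using close[of "exp (-t)"]
        by (simp add: abs_mult mult_left_mono flip: right_diff_distrib)
    qed (simp add: gamma_kernel_def)
  qed (use G in auto)
  also have "\<dots> = e"
    using has_bochner_integral_gamma_kernel[OF assms(1)] G by (auto simp: has_bochner_integral_iff)
  finally show ?thesis .
qed

text \<open>For \<open>g y = y ^ k\<close> the claim is the hypothesis at
  \<open>(k + 1) * d\<close>, and the resulting factor \<open>1 / (k + 1) powr s\<close> is exactly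
  the matching moment. Linearity covers polynomials, and uniform approximation on the unit interval
  covers continuous \<open>g\<close>, since every \<open>exp (- d * lam n)\<close> lies
  there.\<close>

lemma karamata_continuous:
  fixes a lam :: "nat \<Rightarrow> real"
  assumes s: "s > 0" and a: "\<And>n. a n \<ge> 0" and lam: "\<And>n. lam n \<ge> 0"
    and summ: "\<And>d. d > 0 \<Longrightarrow> summable (\<lambda>n. a n * exp (- d * lam n))"
    and lim: "((\<lambda>d. d powr s * (\<Sum>n. a n * exp (- d * lam n))) \<longlongrightarrow> C) (at_right 0)"
    and g: "continuous_on UNIV g"
  shows "((\<lambda>d. d powr s * (\<Sum>n. a n * exp (- d * lam n) * g (exp (- d * lam n))))
            \<longlongrightarrow> C * gamma_mean s g) (at_right 0)"
proof -
  let ?E = "\<lambda>d n. exp (- d * lam n)"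
  define M where "M = (\<lambda>q d. d powr s * (\<Sum>n. a n * ?E d n * q (?E d n)))"
  have bdd: "\<exists>B. \<forall>y. 0 \<le> y \<and> y \<le> 1 \<longrightarrow> \<bar>q y\<bar> \<le> B" if "continuous_on UNIV q" for q :: "real \<Rightarrow> real"
  proof -
    have "continuous_on {0..1} q" using that continuous_on_subset by blast
    then have "bounded (q ` {0..1})" by (intro compact_imp_bounded compact_continuous_image) auto
    then show ?thesis
      unfolding bounded_iff by (metis atLeastAtMost_iff image_eqI real_norm_def)
  qed
  have E: "0 \<le> ?E d n" "?E d n \<le> 1" if "d > 0" for d n
    using that lam[of n] by (auto simp: mult_nonneg_nonneg)
  have summq: "summable (\<lambda>n. a n * ?E d n * q (?E d n))" if q: "continuous_on UNIV q" and d: "d > 0" for q d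
  proof -
    obtain B where B: "\<And>y. 0 \<le> y \<Longrightarrow> y \<le> 1 \<Longrightarrow> \<bar>q y\<bar> \<le> B" using bdd[OF q] by blast
    show ?thesis
    proof (rule summable_comparison_test)
      show "summable (\<lambda>n. a n * ?E d n * B)" using summ[OF d] by (rule summable_mult2)
      show "\<exists>N. \<forall>n\<ge>N. norm (a n * ?E d n * q (?E d n)) \<le> a n * ?E d n * B"
        using a E[OF d] B by (auto simp: abs_mult intro!: mult_left_mono)
    qed
  qed
  have Mdiff: "\<bar>M g d - M p d\<bar> \<le> e * M (\<lambda>_. 1) d"
    if "d > 0" and p: "continuous_on UNIV p" and close: "\<And>y. 0 \<le> y \<Longrightarrow> y \<le> 1 \<Longrightarrow> \<bar>g y - p y\<bar> \<le> e" for d p e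
  proof -
    note S = summq[OF g \<open>d > 0\<close>] summq[OF p \<open>d > 0\<close>]
    have le: "\<bar>a n * ?E d n * g (?E d n) - a n * ?E d n * p (?E d n)\<bar> \<le> a n * ?E d n * e" for n
      using a E[OF \<open>d > 0\<close>] close by (auto simp: abs_mult mult_left_mono simp flip: right_diff_distrib)
    have sm: "summable (\<lambda>n. \<bar>a n * ?E d n * g (?E d n) - a n * ?E d n * p (?E d n)\<bar>)"
      by (rule summable_comparison_test[OF _ summable_mult2[OF summ[OF \<open>d > 0\<close>], of e]]) (use le in auto)
    have "\<bar>M g d - M p d\<bar> = d powr s * \<bar>\<Sum>n. a n * ?E d n * g (?E d n) - a n * ?E d n * p (?E d n)\<bar>"
      unfolding M_def by (subst suminf_diff[OF S, symmetric]) (simp add: abs_mult flip: right_diff_distrib)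
    also have "\<dots> \<le> d powr s * (\<Sum>n. a n * ?E d n * e)"
      using le sm summ[OF \<open>d > 0\<close>]
      by (intro mult_left_mono order.trans[OF summable_rabs] suminf_le summable_mult2) auto
    also have "\<dots> = e * M (\<lambda>_. 1) d"
      using summ[OF \<open>d > 0\<close>] by (simp add: M_def suminf_mult2[symmetric])
    finally show ?thesis .
  qed
  have pow: "(M (\<lambda>y. y ^ k) \<longlongrightarrow> C / real (Suc k) powr s) (at_right 0)" for k
  proof -
    have "filterlim (\<lambda>d. real (Suc k) * d) (at_right 0) (at_right 0)"
    proof (rule tendsto_imp_filterlim_at_right)
      show "((\<lambda>d. real (Suc k) * d) \<longlongrightarrow> 0) (at_right 0)"
        by (intro tendsto_mult_right_zero tendsto_ident_at)
      show "eventually (\<lambda>d. real (Suc k) * d > 0) (at_right 0)"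
        using eventually_at_right_less[of 0] by eventually_elim simp
    qed
    then have "((\<lambda>d. (real (Suc k) * d) powr s * (\<Sum>n. a n * ?E (real (Suc k) * d) n)) \<longlongrightarrow> C) (at_right 0)"
      by (rule filterlim_compose[OF lim])
    then have "((\<lambda>d. (real (Suc k) * d) powr s * (\<Sum>n. a n * ?E (real (Suc k) * d) n) / real (Suc k) powr s)
        \<longlongrightarrow> C / real (Suc k) powr s) (at_right 0)"
      by (intro tendsto_divide tendsto_const) auto
    then show ?thesis
    proof (rule Lim_transform_eventually)
      show "eventually (\<lambda>d. (real (Suc k) * d) powr s * (\<Sum>n. a n * ?E (real (Suc k) * d) n) / real (Suc k) powr s
          = M (\<lambda>y. y ^ k) d) (at_right 0)"
        using eventually_at_right_less[of 0]
      proof eventually_elim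
        case (elim d)
        have "?E (real (Suc k) * d) n = ?E d n * ?E d n ^ k" for n
          by (simp only: exp_of_nat_mult[symmetric] exp_add[symmetric]) (simp add: algebra_simps)
        then show ?case using elim unfolding M_def
          by (simp add: powr_mult mult_ac del: of_nat_Suc)
      qed
    qed
  qed
  have mean_pow: "gamma_mean s (\<lambda>y. y ^ k) = 1 / real (Suc k) powr s" for k
    using has_bochner_integral_gamma_kernel_power[OF s, of k] Gamma_real_pos[OF s]
    by (simp add: gamma_mean_def has_bochner_integral_iff del: of_nat_Suc)
  have poly: "(M p \<longlongrightarrow> C * gamma_mean s p) (at_right 0)" if "p = (\<lambda>x. \<Sum>i\<le>m. c i * x ^ i)" for p c and m :: nat
  proof -
    have "((\<lambda>d. \<Sum>i\<le>m. c i * M (\<lambda>y. y ^ i) d) \<longlongrightarrow> (\<Sum>i\<le>m. c i * (C / real (Suc i) powr s))) (at_right 0)"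
      by (intro tendsto_intros pow)
    also have "(\<Sum>i\<le>m. c i * (C / real (Suc i) powr s)) = C * gamma_mean s p"
    proof -
      have "(\<integral>t. gamma_kernel s t * p (exp (-t)) \<partial>lborel) =
          (\<integral>t. (\<Sum>i\<le>m. c i * (gamma_kernel s t * exp (-t) ^ i)) \<partial>lborel)"
        unfolding that by (intro Bochner_Integration.integral_cong) (auto simp: sum_distrib_left mult_ac)
      also have "\<dots> = (\<Sum>i\<le>m. c i * (Gamma s / real (Suc i) powr s))"
        using has_bochner_integral_gamma_kernel_power[OF s]
        by (subst Bochner_Integration.integral_sum) (auto simp: has_bochner_integral_iff simp del: of_nat_Suc)
      finally show ?thesis using Gamma_real_pos[OF s]
        by (simp add: gamma_mean_def sum_distrib_left sum_divide_distrib mult_ac del: of_nat_Suc)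
    qed
    finally show ?thesis
    proof (rule Lim_transform_eventually)
      show "eventually (\<lambda>d. (\<Sum>i\<le>m. c i * M (\<lambda>y. y ^ i) d) = M p d) (at_right 0)"
        using eventually_at_right_less[of 0]
      proof eventually_elim
        case (elim d)
        have S: "summable (\<lambda>n. a n * ?E d n * ?E d n ^ i)" for i
          using summq[of "\<lambda>y. y ^ i" d] elim by (simp add: continuous_intros)
        have "(\<Sum>n. a n * ?E d n * p (?E d n)) = (\<Sum>n. \<Sum>i\<le>m. c i * (a n * ?E d n * ?E d n ^ i))"
          unfolding that by (simp add: sum_distrib_left mult_ac)
        also have "\<dots> = (\<Sum>i\<le>m. c i * (\<Sum>n. a n * ?E d n * ?E d n ^ i))"
          using S by (subst suminf_sum) (auto intro: summable_mult simp: suminf_mult)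
        finally show ?case
          by (simp add: M_def sum_distrib_left mult_ac)
      qed
    qed
  qed
  have "(M g \<longlongrightarrow> C * gamma_mean s g) (at_right 0)"
  proof (rule tendstoI)
    fix e :: real assume "e > 0"
    \<comment> \<open>Three errors have to fit into \<open>e\<close>:
      \<open>e' * (\<bar>C\<bar> + 1)\<close> for replacing \<open>g\<close> by \<open>p\<close> in
      the sum, \<open>e'\<close> for the convergence for \<open>p\<close>, and
      \<open>\<bar>C\<bar> * e'\<close> for replacing \<open>p\<close> by \<open>g\<close> in the
      mean.\<close>
    define e' where "e' = e / (2 * (\<bar>C\<bar> + 1) + 1)"
    have "e' > 0" using \<open>e > 0\<close> unfolding e'_def by (intro divide_pos_pos) auto
    obtain p where p: "real_polynomial_function p" "\<And>y. y \<in> {0..1} \<Longrightarrow> \<bar>g y - p y\<bar> < e'"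
      using Stone_Weierstrass_real_polynomial_function[of "{0..1::real}" g e'] g \<open>e' > 0\<close>
      by (metis compact_Icc continuous_on_subset subset_UNIV)
    obtain c m where p_eq: "p = (\<lambda>x. \<Sum>i\<le>m. c i * x ^ i)"
      using p(1) unfolding real_polynomial_function_iff_sum by blast
    have cont: "continuous_on UNIV p" unfolding p_eq by (intro continuous_intros)
    have close: "\<bar>g y - p y\<bar> \<le> e'" if "0 \<le> y" "y \<le> 1" for y using p(2)[of y] that by force
    have mean: "\<bar>gamma_mean s g - gamma_mean s p\<bar> \<le> e'"
      by (rule gamma_mean_diff_le[OF s g cont close])
    have "(M (\<lambda>_. 1) \<longlongrightarrow> C) (at_right 0)" using lim by (simp add: M_def)
    then have "eventually (\<lambda>d. dist (M (\<lambda>_. 1) d) C < 1) (at_right 0)" by (rule tendstoD) simp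
    moreover have "eventually (\<lambda>d. dist (M p d) (C * gamma_mean s p) < e') (at_right 0)"
      using poly[OF p_eq] \<open>e' > 0\<close> by (rule tendstoD)
    ultimately show "eventually (\<lambda>d. dist (M g d) (C * gamma_mean s g) < e) (at_right 0)"
      using eventually_at_right_less[of 0]
    proof eventually_elim
      case (elim d)
      have 1: "\<bar>M g d - M p d\<bar> \<le> e' * (\<bar>C\<bar> + 1)"
      proof -
        have "M (\<lambda>_. 1) d \<le> \<bar>C\<bar> + 1" using elim by (auto simp: dist_real_def)
        then show ?thesis
          using Mdiff[OF \<open>0 < d\<close> cont close] \<open>e' > 0\<close> by (smt (verit) mult_left_mono)
      qed
      have 2: "\<bar>C * gamma_mean s p - C * gamma_mean s g\<bar> \<le> \<bar>C\<bar> * e'"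
        using mean by (simp add: abs_mult mult_left_mono abs_minus_commute flip: right_diff_distrib)
      have "2 * (\<bar>C\<bar> + 1) + 1 > 0" by (intro add_nonneg_pos mult_nonneg_nonneg) auto
      then have "e' * (2 * (\<bar>C\<bar> + 1) + 1) = e" by (simp add: e'_def)
      then have "e = e' * (\<bar>C\<bar> + 1) + e' * (\<bar>C\<bar> + 1) + e'"
        by (simp only: ring_distribs)
      moreover have "\<bar>M p d - C * gamma_mean s p\<bar> < e'" using elim by (simp add: dist_real_def)
      moreover have "e' * (\<bar>C\<bar> + 1) = \<bar>C\<bar> * e' + e'" by (simp add: algebra_simps)
      ultimately show ?case using 1 2 \<open>e' > 0\<close> unfolding dist_real_def by linarith
    qed
  qed
  then show ?thesis by (simp add: M_def)
qed


lemma has_bochner_integral_power_interval: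
  fixes s b :: real
  assumes "s > 0" "b \<ge> 0"
  shows "has_bochner_integral lborel (\<lambda>t. indicator {0..b} t * t powr (s - 1)) (b powr s / s)"
proof (rule has_bochner_integral_nn_integral)
  have "((\<lambda>x. x powr (s - 1)) has_integral (b powr s / s)) {0..b}"
    using has_integral_powr_from_0[of "s - 1" b] assms by simp
  then show "(\<integral>\<^sup>+t. ennreal (indicator {0..b} t * t powr (s - 1)) \<partial>lborel) = ennreal (b powr s / s)"
    by (intro nn_integral_has_integral_lebesgue) auto
qed (use assms in auto)

text \<open>The partial sum up to \<open>T\<close> is the weighted sum at \<open>d = 1 / T\<close>
  for the discontinuous function equal to \<open>1 / y\<close> for \<open>y \<ge> exp (-1)\<close>
  and 0 below. It is squeezed between continuous functions whose means come arbitrarily close to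
  \<open>1 / Gamma (s + 1)\<close>.\<close>

lemma karamata:
  fixes a lam :: "nat \<Rightarrow> real"
  assumes s: "s > 0" and a: "\<And>n. a n \<ge> 0" and lam: "\<And>n. lam n \<ge> 0"
    and summ: "\<And>d. d > 0 \<Longrightarrow> summable (\<lambda>n. a n * exp (- d * lam n))"
    and lim: "((\<lambda>d. d powr s * (\<Sum>n. a n * exp (- d * lam n))) \<longlongrightarrow> C) (at_right 0)"
  shows "((\<lambda>T. (\<Sum>n. a n * of_bool (lam n \<le> T)) / T powr s) \<longlongrightarrow> C / Gamma (s + 1)) at_top"
proof -
  let ?E = "\<lambda>d n. exp (- d * lam n)"
  define S where "S = (\<lambda>T. \<Sum>n. a n * of_bool (lam n \<le> T))"
  define M where "M = (\<lambda>q d. d powr s * (\<Sum>n. a n * ?E d n * q (?E d n)))"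
  \<comment> \<open>Up to the factor \<open>1 / y\<close> a ramp from 0 at
    \<open>exp (-\<beta>)\<close> to 1 at \<open>exp (-\<alpha>)\<close>, so that
    \<open>y * q \<alpha> \<beta> y\<close> at \<open>y = exp (-t)\<close> lies between the
    indicators of \<open>t \<le> \<alpha>\<close> and \<open>t \<le> \<beta>\<close>. The
    denominator equals \<open>y\<close> wherever the ramp is positive and avoids a pole at
    0.\<close>
  define q where "q = (\<lambda>\<alpha> \<beta> y :: real. max 0 (min 1 ((y - exp (-\<beta>)) / (exp (-\<alpha>) - exp (-\<beta>)))) / max y (exp (-\<beta>)))"
  have cont: "continuous_on UNIV (q \<alpha> \<beta>)" if "\<alpha> < \<beta>" for \<alpha> \<beta>
  proof -
    have "max y (exp (-\<beta>)) \<noteq> 0" for y :: real by (smt (verit) exp_gt_zero)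
    then show ?thesis using that unfolding q_def by (intro continuous_intros) auto
  qed
  have q_bounds: "of_bool (t \<le> \<alpha>) \<le> exp (-t) * q \<alpha> \<beta> (exp (-t))" 
      "exp (-t) * q \<alpha> \<beta> (exp (-t)) \<le> of_bool (t \<le> \<beta>)" "0 \<le> q \<alpha> \<beta> (exp (-t))" if "\<alpha> < \<beta>" for t \<alpha> \<beta> :: real
  proof -
    define r where "r = max 0 (min 1 ((exp (-t) - exp (-\<beta>)) / (exp (-\<alpha>) - exp (-\<beta>))))"
    have pos: "exp (-\<alpha>) - exp (-\<beta>) > 0" using that by simp
    have r: "0 \<le> r" "r \<le> 1" by (auto simp: r_def)
    have r1: "r = 1" if "t \<le> \<alpha>"
      using pos that by (simp add: r_def min_def field_simps)
    have r0: "r = 0" if "\<not> t \<le> \<beta>"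
      using pos that by (simp add: r_def max_def min_def zero_le_divide_iff not_le)
    have eq: "exp (-t) * q \<alpha> \<beta> (exp (-t)) = r" if "t \<le> \<beta>"
    proof -
      have "max (exp (-t)) (exp (-\<beta>)) = exp (-t)" using that by (intro max_absorb1) simp
      then show ?thesis unfolding q_def r_def by simp
    qed
    have eq0: "q \<alpha> \<beta> (exp (-t)) = 0" if "\<not> t \<le> \<beta>"
      using r0[OF that] by (simp add: q_def r_def[symmetric])
    show "of_bool (t \<le> \<alpha>) \<le> exp (-t) * q \<alpha> \<beta> (exp (-t))" 
      "exp (-t) * q \<alpha> \<beta> (exp (-t)) \<le> of_bool (t \<le> \<beta>)" 
      using eq eq0 r r1 \<open>\<alpha> < \<beta>\<close> by (cases "t \<le> \<beta>"; cases "t \<le> \<alpha>"; auto)+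
    show "0 \<le> q \<alpha> \<beta> (exp (-t))"
      unfolding q_def by (intro divide_nonneg_nonneg) (auto simp: le_max_iff_disj)
  qed
  have G: "Gamma s > 0" "Gamma (s + 1) = s * Gamma s"
  proof -
    show "Gamma s > 0" using s by (rule Gamma_real_pos)
    have "s \<notin> \<int>\<^sub>\<le>\<^sub>0" using s by (auto elim!: nonpos_Ints_cases)
    then show "Gamma (s + 1) = s * Gamma s" by (rule Gamma_plus1)
  qed
  \<comment> \<open>The indicator of \<open>t \<le> b\<close> has mean
    \<open>b powr s / (s * Gamma s)\<close>, because the factor \<open>exp (-t)\<close> of the
    kernel cancels against \<open>1 / y\<close>.\<close>
  have mean_bounds: "\<alpha> powr s / Gamma (s + 1) \<le> gamma_mean s (q \<alpha> \<beta>)" 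
    "gamma_mean s (q \<alpha> \<beta>) \<le> \<beta> powr s / Gamma (s + 1)" if ab: "0 \<le> \<alpha>" "\<alpha> < \<beta>" for \<alpha> \<beta>
  proof -
    have le1: "indicator {0..\<alpha>} t * t powr (s - 1) \<le> gamma_kernel s t * q \<alpha> \<beta> (exp (-t))"
     and le2: "gamma_kernel s t * q \<alpha> \<beta> (exp (-t)) \<le> indicator {0..\<beta>} t * t powr (s - 1)" for t
    proof -
      define w where "w = indicator {0..} t * t powr (s - 1)"
      have w: "w \<ge> 0" by (simp add: w_def)
      have 1: "gamma_kernel s t * q \<alpha> \<beta> (exp (-t)) = w * (exp (-t) * q \<alpha> \<beta> (exp (-t)))"
        by (simp add: gamma_kernel_def w_def exp_minus divide_inverse mult_ac)
      have 2: "indicator {0..c} t * t powr (s - 1) = w * of_bool (t \<le> c)" for c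
        by (auto simp: indicator_def w_def)
      show "indicator {0..\<alpha>} t * t powr (s - 1) \<le> gamma_kernel s t * q \<alpha> \<beta> (exp (-t))"
         "gamma_kernel s t * q \<alpha> \<beta> (exp (-t)) \<le> indicator {0..\<beta>} t * t powr (s - 1)"
        unfolding 1 2 using q_bounds[OF ab(2), of t] w by (intro mult_left_mono; simp)+
    qed
    have b: "0 \<le> \<beta>" using ab by simp
    note I = has_bochner_integral_power_interval[OF s ab(1)] has_bochner_integral_power_interval[OF s b]
    have int: "integrable lborel (\<lambda>t. gamma_kernel s t * q \<alpha> \<beta> (exp (-t)))"
    proof (rule Bochner_Integration.integrable_bound)
      show "integrable lborel (\<lambda>t. indicator {0..\<beta>} t * t powr (s - 1))"
        using I(2) by (simp add: has_bochner_integral_iff)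
      show "(\<lambda>t. gamma_kernel s t * q \<alpha> \<beta> (exp (-t))) \<in> borel_measurable lborel"
        using borel_measurable_continuous_onI[OF cont[OF ab(2)]] by measurable
      show "AE t in lborel. norm (gamma_kernel s t * q \<alpha> \<beta> (exp (-t))) \<le> norm (indicator {0..\<beta>} t * t powr (s - 1))"
        using le2 q_bounds(3)[OF ab(2)] by (intro AE_I2) (simp add: abs_mult)
    qed
    have "\<alpha> powr s / s \<le> (\<integral>t. gamma_kernel s t * q \<alpha> \<beta> (exp (-t)) \<partial>lborel)"
      using integral_mono[OF _ int le1] I(1) by (simp add: has_bochner_integral_iff)
    then show "\<alpha> powr s / Gamma (s + 1) \<le> gamma_mean s (q \<alpha> \<beta>)"
      unfolding gamma_mean_def G(2) using G(1)
      by (simp only: divide_divide_eq_left[symmetric] divide_right_mono less_imp_le)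
    have "(\<integral>t. gamma_kernel s t * q \<alpha> \<beta> (exp (-t)) \<partial>lborel) \<le> \<beta> powr s / s"
      using integral_mono[OF int _ le2] I(2) by (simp add: has_bochner_integral_iff)
    then show "gamma_mean s (q \<alpha> \<beta>) \<le> \<beta> powr s / Gamma (s + 1)"
      unfolding gamma_mean_def G(2) using G(1)
      by (simp only: divide_divide_eq_left[symmetric] divide_right_mono less_imp_le)
  qed
  have summS: "summable (\<lambda>n. a n * of_bool (lam n \<le> T))" for T
  proof (rule summable_comparison_test)
    show "summable (\<lambda>n. a n * ?E 1 n * exp T)" using summ[of 1] by (intro summable_mult2) auto
    have le: "of_bool (lam n \<le> T) \<le> ?E 1 n * exp T" for n by (simp flip: exp_add)
    have "norm (a n * of_bool (lam n \<le> T)) \<le> a n * ?E 1 n * exp T" for n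
      using mult_left_mono[OF le a[of n]] a[of n] by (simp add: mult.assoc)
    then show "\<exists>N. \<forall>n\<ge>N. norm (a n * of_bool (lam n \<le> T)) \<le> a n * ?E 1 n * exp T" by blast
  qed
  have S_bounds: "S (\<alpha> * T) / T powr s \<le> M (q \<alpha> \<beta>) (1 / T)" "M (q \<alpha> \<beta>) (1 / T) \<le> S (\<beta> * T) / T powr s"
    if ab: "\<alpha> < \<beta>" and T: "T > 0" for T \<alpha> \<beta>
  proof -
    have le: "a n * of_bool (lam n \<le> \<alpha> * T) \<le> a n * ?E (1/T) n * q \<alpha> \<beta> (?E (1/T) n)"
       "a n * ?E (1/T) n * q \<alpha> \<beta> (?E (1/T) n) \<le> a n * of_bool (lam n \<le> \<beta> * T)"
       "0 \<le> a n * ?E (1/T) n * q \<alpha> \<beta> (?E (1/T) n)" for n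
    proof -
      define z where "z = ?E (1/T) n * q \<alpha> \<beta> (?E (1/T) n)"
      have z: "of_bool (lam n \<le> \<alpha> * T) \<le> z" "z \<le> of_bool (lam n \<le> \<beta> * T)" "0 \<le> z"
        using q_bounds[OF ab, of "lam n / T"] T unfolding z_def
        by (simp_all add: pos_divide_le_eq)
      show "a n * of_bool (lam n \<le> \<alpha> * T) \<le> a n * ?E (1/T) n * q \<alpha> \<beta> (?E (1/T) n)"
       "a n * ?E (1/T) n * q \<alpha> \<beta> (?E (1/T) n) \<le> a n * of_bool (lam n \<le> \<beta> * T)"
       "0 \<le> a n * ?E (1/T) n * q \<alpha> \<beta> (?E (1/T) n)"
        unfolding mult.assoc z_def[symmetric]
        using z a[of n] by - ((rule mult_left_mono mult_nonneg_nonneg; assumption)+)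
    qed
    have sm: "summable (\<lambda>n. a n * ?E (1/T) n * q \<alpha> \<beta> (?E (1/T) n))"
      by (rule summable_comparison_test[OF _ summS[of "\<beta> * T"]]) (use le in auto)
    have "S (\<alpha> * T) \<le> (\<Sum>n. a n * ?E (1/T) n * q \<alpha> \<beta> (?E (1/T) n))"
      "(\<Sum>n. a n * ?E (1/T) n * q \<alpha> \<beta> (?E (1/T) n)) \<le> S (\<beta> * T)"
      unfolding S_def by (intro suminf_le le sm summS)+
    then show "S (\<alpha> * T) / T powr s \<le> M (q \<alpha> \<beta>) (1 / T)" "M (q \<alpha> \<beta>) (1 / T) \<le> S (\<beta> * T) / T powr s"
      using T by (auto simp: M_def powr_divide field_simps)
  qed
  have lim_q: "((\<lambda>T. M (q \<alpha> \<beta>) (1 / T)) \<longlongrightarrow> C * gamma_mean s (q \<alpha> \<beta>)) at_top" if "\<alpha> < \<beta>" for \<alpha> \<beta>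
  proof -
    have "filterlim (\<lambda>T::real. 1 / T) (at_right 0) at_top"
      using filterlim_inverse_at_right_top by (simp add: inverse_eq_divide)
    then show ?thesis
      using filterlim_compose[OF karamata_continuous[OF s a lam summ lim cont[OF that]]]
      unfolding M_def by blast
  qed
  have "C \<ge> 0"
  proof (rule tendsto_lowerbound[OF lim])
    show "eventually (\<lambda>d. 0 \<le> d powr s * (\<Sum>n. a n * ?E d n)) (at_right 0)"
      using eventually_at_right_less[of 0] 
      by eventually_elim (use a summ in \<open>auto intro!: mult_nonneg_nonneg suminf_nonneg\<close>)
  qed simp
  have cont_powr: "((\<lambda>\<eta>. C * ((1 + c * \<eta>) powr s / Gamma (s + 1))) \<longlongrightarrow> C / Gamma (s + 1)) (at_right 0)" for c
  proof -
    have "((\<lambda>\<eta>. C * ((1 + c * \<eta>) powr s / Gamma (s + 1))) \<longlongrightarrow> C * ((1 + c * 0) powr s / Gamma (s + 1))) (at_right 0)"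
    proof (intro tendsto_intros)
      show "Gamma (s + 1) \<noteq> 0" using G s by (metis mult_pos_pos less_irrefl)
    qed auto
    then show ?thesis by simp
  qed
  have ev1: "eventually (\<lambda>\<eta>::real. 0 < \<eta> \<and> \<eta> < 1) (at_right 0)"
    by (auto simp: eventually_at_right_field intro!: exI[of _ 1])
  have "((\<lambda>T. S T / T powr s) \<longlongrightarrow> C / Gamma (s + 1)) at_top"
  proof (rule order_tendstoI)
    \<comment> \<open>The upper estimate puts the ramp just outside the cut, from 1 to
      \<open>1 + \<eta>\<close>; the lower estimate puts it just inside, from
      \<open>1 - \<eta>\<close> to 1.\<close>
    fix u assume "C / Gamma (s + 1) < u"
    from order_tendstoD(2)[OF cont_powr[of 1] this]
    obtain \<eta> where \<eta>: "0 < \<eta>" "\<eta> < 1" "C * ((1 + \<eta>) powr s / Gamma (s + 1)) < u"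
      using eventually_happens[OF eventually_conj[OF ev1]] by (auto simp: trivial_limit_at_right_real)
    have "C * gamma_mean s (q 1 (1 + \<eta>)) < u"
      using mult_left_mono[OF mean_bounds(2)[of 1 "1 + \<eta>"] \<open>C \<ge> 0\<close>] \<eta> by simp
    from order_tendstoD(2)[OF lim_q[of 1 "1 + \<eta>"] this] \<eta> eventually_gt_at_top[of 0]
    have "eventually (\<lambda>T. M (q 1 (1 + \<eta>)) (1 / T) < u \<and> T > 0) at_top"
      by (auto simp: eventually_conj_iff)
    then show "eventually (\<lambda>T. S T / T powr s < u) at_top"
      by eventually_elim (use S_bounds(1)[of 1 "1 + \<eta>"] \<eta> in force)
  next
    fix u assume "u < C / Gamma (s + 1)"
    from order_tendstoD(1)[OF cont_powr[of "-1"] this]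
    obtain \<eta> where \<eta>: "0 < \<eta>" "\<eta> < 1" "u < C * ((1 - \<eta>) powr s / Gamma (s + 1))"
      using eventually_happens[OF eventually_conj[OF ev1]] by (auto simp: trivial_limit_at_right_real)
    have "u < C * gamma_mean s (q (1 - \<eta>) 1)"
      using mult_left_mono[OF mean_bounds(1)[of "1 - \<eta>" 1] \<open>C \<ge> 0\<close>] \<eta> by simp
    from order_tendstoD(1)[OF lim_q[of "1 - \<eta>" 1] this] \<eta> eventually_gt_at_top[of 0]
    have "eventually (\<lambda>T. u < M (q (1 - \<eta>) 1) (1 / T) \<and> T > 0) at_top"
      by (auto simp: eventually_conj_iff)
    then show "eventually (\<lambda>T. u < S T / T powr s) at_top"
      by eventually_elim (use S_bounds(2)[of "1 - \<eta>" 1] \<eta> in force)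
  qed
  then show ?thesis by (simp add: S_def)
qed

section \<open>Chebyshev functions and Dirichlet series of balanced classes\<close>

text \<open>A fixed initial segment contributes nothing in the limit because each single weight
  vanishes, and beyond it \<open>x\<close> is small while the total weight stays bounded. The filter
  is arbitrary since such averages occur both for \<open>n\<close> tending to infinity and for
  \<open>d\<close> tending to 0.\<close>

lemma toeplitz_tendsto_0:
  fixes c :: "'a \<Rightarrow> nat \<Rightarrow> real"
  assumes x: "x \<longlonglongrightarrow> (0::real)"
    and c: "eventually (\<lambda>t. (\<forall>k. c t k \<ge> 0) \<and> summable (c t) \<and> suminf (c t) \<le> C) F"
    and lim: "\<And>k. ((\<lambda>t. c t k) \<longlongrightarrow> 0) F"
  shows "((\<lambda>t. \<Sum>k. c t k * x k) \<longlongrightarrow> 0) F"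
proof (rule tendstoI)
  fix e :: real assume "e > 0"
  define e' where "e' = e / (2 * (\<bar>C\<bar> + 1))"
  have e': "e' > 0" "e' * \<bar>C\<bar> < e / 2"
    using \<open>e > 0\<close> by (auto simp: e'_def field_simps add_pos_nonneg add_nonneg_pos)
  obtain N where N: "\<And>k. k \<ge> N \<Longrightarrow> \<bar>x k\<bar> < e'"
    using tendstoD[OF x \<open>e' > 0\<close>] by (auto simp: eventually_at_top_linorder)
  have "((\<lambda>t. \<Sum>k<N. c t k * \<bar>x k\<bar>) \<longlongrightarrow> (\<Sum>k<N. 0 * \<bar>x k\<bar>)) F"
    by (intro tendsto_intros lim)
  then have "eventually (\<lambda>t. (\<Sum>k<N. c t k * \<bar>x k\<bar>) < e / 2) F"
    using \<open>e > 0\<close> by (intro order_tendstoD(2)[where y = 0]) auto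
  with c show "eventually (\<lambda>t. dist (\<Sum>k. c t k * x k) 0 < e) F"
  proof eventually_elim
    case (elim t)
    then have c0: "\<And>k. c t k \<ge> 0" and cs: "summable (c t)" by auto
    have "norm (c t k * x k) \<le> c t k * e'" if "k \<ge> N" for k
      using N[OF that] c0[of k] by (auto simp: abs_mult intro!: mult_left_mono)
    then have sm: "summable (\<lambda>k. \<bar>c t k * x k\<bar>)"
      by (intro summable_comparison_test[OF _ summable_mult2[OF cs, of e']]) auto
    have "\<bar>\<Sum>k. c t k * x k\<bar> \<le> (\<Sum>k. \<bar>c t k * x k\<bar>)" by (rule summable_rabs[OF sm])
    also have "\<dots> = (\<Sum>k. \<bar>c t (k + N) * x (k + N)\<bar>) + (\<Sum>k<N. \<bar>c t k * x k\<bar>)"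
      by (rule suminf_split_initial_segment[OF sm])
    also have "(\<Sum>k<N. \<bar>c t k * x k\<bar>) = (\<Sum>k<N. c t k * \<bar>x k\<bar>)"
      using c0 by (simp add: abs_mult)
    also have "(\<Sum>k. \<bar>c t (k + N) * x (k + N)\<bar>) \<le> (\<Sum>k. c t (k + N) * e')"
    proof (rule suminf_le)
      show "\<bar>c t (k + N) * x (k + N)\<bar> \<le> c t (k + N) * e'" for k
        using c0[of "k + N"] less_imp_le[OF N[of "k + N"]] by (auto simp: abs_mult intro!: mult_left_mono)
    qed (intro summable_ignore_initial_segment[OF sm] summable_mult2 summable_ignore_initial_segment[OF cs])+
    also have "\<dots> = (\<Sum>k. c t (k + N)) * e'"
      by (rule suminf_mult2[symmetric]) (rule summable_ignore_initial_segment[OF cs])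
    also have "\<dots> \<le> suminf (c t) * e'"
      using suminf_split_initial_segment[OF cs, of N] c0 e'
      by (intro mult_right_mono) (auto intro!: sum_nonneg)
    also have "\<dots> \<le> \<bar>C\<bar> * e'" using elim e' by (intro mult_right_mono) auto
    finally show ?case using e' elim by (simp add: mult.commute)
  qed
qed

lemma weighted_cesaro_tendsto_0:
  fixes c x :: "nat \<Rightarrow> real"
  assumes x: "x \<longlonglongrightarrow> 0" and c: "\<And>k. c k \<ge> 0" and le: "\<And>n. (\<Sum>k<n. c k) \<le> C * real n"
  shows "(\<lambda>n. (\<Sum>k<n. c k * x k) / real n) \<longlonglongrightarrow> 0"
proof -
  have *: "(\<lambda>k. (if k < n then c k / real n else 0) * y k) sums (\<Sum>k<n. c k / real n * y k)" for n and y :: "nat \<Rightarrow> real"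
    using sums_If_finite_set[of "{..<n}" "\<lambda>k. c k / real n * y k"] by (simp add: if_distrib[of "\<lambda>z. z * _"] cong: if_cong)
  have "((\<lambda>n. \<Sum>k. (if k < n then c k / real n else 0) * x k) \<longlonglongrightarrow> 0)"
  proof (rule toeplitz_tendsto_0[OF x, where C = C])
    show "eventually (\<lambda>n. (\<forall>k. (if k < n then c k / real n else 0) \<ge> 0) \<and>
      summable (\<lambda>k. if k < n then c k / real n else 0) \<and> (\<Sum>k. if k < n then c k / real n else 0) \<le> C) sequentially"
      using eventually_gt_at_top[of 0]
    proof eventually_elim
      case (elim n)
      have "(\<lambda>k. if k < n then c k / real n else 0) sums ((\<Sum>k<n. c k) / real n)"
        using *[of n "\<lambda>_. 1"] by (simp add: sum_divide_distrib)
      moreover have "(\<Sum>k<n. c k) / real n \<le> C"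
        using le[of n] elim by (simp add: divide_le_eq)
      ultimately show ?case using c by (auto simp: sums_iff)
    qed
    fix k
    have "(\<lambda>n. c k / real n) \<longlonglongrightarrow> 0" by real_asymp
    then show "(\<lambda>n. if k < n then c k / real n else 0) \<longlonglongrightarrow> 0"
      by (rule Lim_transform_eventually) (use eventually_gt_at_top[of k] in eventually_elim, auto)
  qed
  then show ?thesis using *[of _ x] by (simp add: sums_iff sum_divide_distrib)
qed

section \<open>From balanced loads to balanced Chebyshev functions\<close>

lemma sum_mult_diff_by_parts:
  fixes b d :: "nat \<Rightarrow> real"
  shows "(\<Sum>k<n. b k * (D (Suc k) - D k)) = b n * D n - b 0 * D 0 - (\<Sum>k<n. D (Suc k) * (b (Suc k) - b k))"
  by (induction n) (auto simp: algebra_simps)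

text \<open>The reciprocal of \<open>prime_weight 1 k\<close> for prime \<open>k\<close>, extended smoothly to all \<open>k\<close>.\<close>

definition weight_inv :: "nat \<Rightarrow> real" where
  "weight_inv k = 1 / ln (real k / (real k - 1))"

lemma weight_inv_bounds:
  assumes "k \<ge> 2"
  shows "real k - 1 \<le> weight_inv k" "weight_inv k \<le> real k"
proof -
  have k: "real k \<ge> 2" using assms by simp
  have pos: "ln (real k / (real k - 1)) > 0" using k by (intro ln_gt_zero) (auto simp: field_simps)
  have "ln (real k / (real k - 1)) \<le> real k / (real k - 1) - 1"
    using k by (intro ln_le_minus_one) auto
  also have "\<dots> = 1 / (real k - 1)" using k by (simp add: field_simps)
  finally show "real k - 1 \<le> weight_inv k"
    using pos k by (simp add: weight_inv_def field_simps)
  have "ln ((real k - 1) / real k) \<le> (real k - 1) / real k - 1"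
    using k by (intro ln_le_minus_one) auto
  then have "1 / real k \<le> ln (real k / (real k - 1))"
    using k by (simp add: ln_div field_simps)
  then show "weight_inv k \<le> real k"
    using pos k by (simp add: weight_inv_def field_simps)
qed

definition theta_diff :: "nat set \<Rightarrow> nat set \<Rightarrow> nat \<Rightarrow> real" where
  "theta_diff P Q n = (\<Sum>k=1..n. of_bool (prime k) * ((of_bool (k \<in> P) - of_bool (k \<in> Q)) * ln (real k)))"

definition weight_diff :: "nat set \<Rightarrow> nat set \<Rightarrow> nat \<Rightarrow> real" where
  "weight_diff P Q n = (\<Sum>k=1..n. (of_bool (k \<in> P) - of_bool (k \<in> Q)) * prime_weight 1 k)"

text \<open>At a prime \<open>weight_inv k\<close> cancels the weight and leaves
  \<open>ln k\<close>; elsewhere \<open>weight_diff\<close> does not change. The sum starts at 2, as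
  \<open>weight_inv 1\<close> would involve a division by 0.\<close>

lemma theta_diff_eq:
  "theta_diff P Q (n + 2) = (\<Sum>k<n+1. ln (real (k+2)) * weight_inv (k+2) * (weight_diff P Q (Suc k + 1) - weight_diff P Q (k + 1)))"
proof -
  have "weight_inv k * prime_weight 1 k = of_bool (prime k)" for k
  proof (cases "prime k")
    case True
    then have "real k \<ge> 2" using prime_ge_2_nat[of k] by simp
    then have "ln (real k / (real k - 1)) > 0" by (intro ln_gt_zero) (auto simp: field_simps)
    then show ?thesis using True by (simp add: prime_weight_1 weight_inv_def)
  qed (simp add: prime_weight_def)
  then have *: "ln (real k) * weight_inv k * (c * prime_weight 1 k) = of_bool (prime k) * (c * ln (real k))" for k c
    by (metis mult.assoc mult.commute mult.left_commute)
  have "theta_diff P Q (n + 2) = (\<Sum>k<n+2. of_bool (prime (k+1)) * ((of_bool (k+1 \<in> P) - of_bool (k+1 \<in> Q)) * ln (real (k+1))))"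
    unfolding theta_diff_def
    by (rule sum.reindex_bij_witness[of _ "\<lambda>k. k + 1" "\<lambda>k. k - 1"]) auto
  also have "\<dots> = (\<Sum>k<n+1. of_bool (prime (k+2)) * ((of_bool (k+2 \<in> P) - of_bool (k+2 \<in> Q)) * ln (real (k+2))))"
    using sum.lessThan_Suc_shift[of "\<lambda>k. of_bool (prime (k+1)) * ((of_bool (k+1 \<in> P) - of_bool (k+1 \<in> Q)) * ln (real (k+1)))" "n + 1"]
    by simp
  also have "\<dots> = (\<Sum>k<n+1. ln (real (k+2)) * weight_inv (k+2) * (weight_diff P Q (Suc k + 1) - weight_diff P Q (k + 1)))"
  proof (intro sum.cong refl)
    fix k
    have "weight_diff P Q (Suc k + 1) - weight_diff P Q (k + 1) = (of_bool (k+2 \<in> P) - of_bool (k+2 \<in> Q)) * prime_weight 1 (k+2)"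
      by (simp add: weight_diff_def)
    then show "of_bool (prime (k+2)) * ((of_bool (k+2 \<in> P) - of_bool (k+2 \<in> Q)) * ln (real (k+2))) =
      ln (real (k+2)) * weight_inv (k+2) * (weight_diff P Q (Suc k + 1) - weight_diff P Q (k + 1))"
      by (simp only: *)
  qed
  finally show ?thesis .
qed

text \<open>Summation by parts against \<open>b\<close>, which up to a shift grows like
  \<open>k * ln k\<close>. Since \<open>D k * ln k\<close> tends to 0, the boundary term is o(n).
  The increments of \<open>b\<close> are only of order \<open>ln k\<close>; dividing by this
  logarithm gives weights \<open>c\<close> of total O(n), to which Cesaro averaging applies.\<close>

lemma theta_diff_littleo:
  assumes "(\<lambda>n. weight_diff P Q n * ln (real n)) \<longlonglongrightarrow> 0"
  shows "(\<lambda>n. theta_diff P Q n / real n) \<longlonglongrightarrow> 0"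
proof -
  define D where "D = weight_diff P Q"
  define b where "b = (\<lambda>k. ln (real (k+2)) * weight_inv (k+2))"
  define c where "c = (\<lambda>k. \<bar>b (Suc k) - b k\<bar> / ln (real (k+2)))"
  define x where "x = (\<lambda>k. \<bar>D (k + 2)\<bar> * ln (real (k + 2)))"
  have lnpos: "ln (real (k+2)) > 0" for k by simp
  have lim: "(\<lambda>k. D (k + 2) * ln (real (k + 2))) \<longlonglongrightarrow> 0"
    using LIMSEQ_ignore_initial_segment[OF assms, of 2] by (simp add: D_def)
  then have x: "x \<longlonglongrightarrow> 0"
    using tendsto_rabs_zero[OF lim] by (simp add: x_def abs_mult)
  \<comment> \<open>The increment of a product splits into a telescoping increment of
    \<open>weight_inv\<close> times \<open>ln (k + 2)\<close> and a remainder of at most 2. As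
    \<open>ln (k + 2) \<ge> 1 / 2\<close>, the remainder is at most
    \<open>5 * ln (k + 2)\<close>.\<close>
  have c_le: "c k \<le> weight_inv (k+3) - weight_inv (k+2) + 5" for k
  proof -
    let ?u = "weight_inv (k+2)" and ?v = "weight_inv (k+3)"
    let ?l = "ln (real (k+2))" and ?m = "ln (real (k+3))"
    have uv: "?u \<ge> real k + 1" "?u \<le> real k + 2" "?v \<ge> real k + 2" "?v \<le> real k + 3"
      using weight_inv_bounds[of "k+2"] weight_inv_bounds[of "k+3"] by auto
    have ml: "?l \<le> ?m" by simp
    have "?m - ?l = ln (real (k+3) / real (k+2))" by (simp add: ln_div)
    also have "\<dots> \<le> real (k+3) / real (k+2) - 1" by (intro ln_le_minus_one) auto
    also have "\<dots> = 1 / (real k + 2)" by (simp add: field_simps)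
    finally have diff: "?m - ?l \<le> 1 / (real k + 2)" .
    have eq: "b (Suc k) - b k = ?l * (?v - ?u) + (?m - ?l) * ?v"
      by (simp add: b_def numeral_eq_Suc algebra_simps)
    have nn: "b (Suc k) - b k \<ge> 0"
      unfolding eq using uv ml lnpos[of k] by (intro add_nonneg_nonneg mult_nonneg_nonneg) auto
    have l2: "?l \<ge> 1 / 2"
    proof -
      have "ln 2 \<le> ?l" by simp
      then show ?thesis using ln2_ge_two_thirds by linarith
    qed
    have "(?m - ?l) * ?v \<le> 1 / (real k + 2) * (real k + 3)"
      using diff uv by (intro mult_mono) auto
    also have "\<dots> \<le> 2" by (simp add: field_simps)
    also have "2 \<le> 5 * ?l" using l2 by linarith
    finally have "b (Suc k) - b k \<le> (?v - ?u + 5) * ?l" unfolding eq by (simp add: algebra_simps)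
    then show ?thesis unfolding c_def using nn lnpos[of k] by (simp add: divide_le_eq)
  qed
  have sum_c: "(\<Sum>k<n. c k) \<le> 7 * real n" for n
  proof -
    have "(\<Sum>k<n. c k) \<le> (\<Sum>k<n. weight_inv (k+3) - weight_inv (k+2) + 5)" by (intro sum_mono c_le)
    also have "\<dots> = weight_inv (n + 2) - weight_inv 2 + 5 * real n"
      by (induction n) (auto simp: numeral_eq_Suc algebra_simps)
    also have "\<dots> \<le> 6 * real n + 1"
      using weight_inv_bounds[of "n + 2"] weight_inv_bounds[of 2] by simp
    finally show ?thesis by (cases n) auto
  qed
  have b0: "b k * \<bar>y\<bar> \<le> (real k + 2) * (\<bar>y\<bar> * ln (real (k+2)))" for k y
    unfolding b_def using weight_inv_bounds[of "k+2"] lnpos[of k]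
    by (simp add: mult_ac mult_left_mono)
  have main: "\<bar>theta_diff P Q (n + 2)\<bar> \<le> (real n + 3) * (\<bar>D (n + 2)\<bar> * ln (real (n + 3))) + (\<Sum>k<n+1. c k * x k)" for n
  proof -
    have "D 1 = 0" by (simp add: D_def weight_diff_def prime_weight_def)
    then have "theta_diff P Q (n + 2) = b (n + 1) * D (n + 2) - (\<Sum>k<n+1. D (k + 2) * (b (Suc k) - b k))"
      using sum_mult_diff_by_parts[of b "\<lambda>k. D (k + 1)" "n + 1"]
      unfolding theta_diff_eq by (simp add: b_def D_def)
    also have "\<bar>\<dots>\<bar> \<le> \<bar>b (n + 1) * D (n + 2)\<bar> + \<bar>\<Sum>k<n+1. D (k + 2) * (b (Suc k) - b k)\<bar>"
      by (rule abs_triangle_ineq4)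
    also have "\<bar>\<Sum>k<n+1. D (k + 2) * (b (Suc k) - b k)\<bar> \<le> (\<Sum>k<n+1. c k * x k)"
      using lnpos by (intro order.trans[OF sum_abs] sum_mono) (simp add: c_def x_def abs_mult)
    also have "\<bar>b (n + 1) * D (n + 2)\<bar> = b (n + 1) * \<bar>D (n + 2)\<bar>"
      using weight_inv_bounds[of "n+3"] by (simp add: abs_mult b_def numeral_eq_Suc)
    also have "\<dots> \<le> (real n + 3) * (\<bar>D (n + 2)\<bar> * ln (real (n + 3)))"
      using b0[of "n + 1" "D (n + 2)"] by (simp add: add_ac)
    finally show ?thesis by simp
  qed
  have lim0: "(\<lambda>n. (real n + 3) * (\<bar>D (n + 2)\<bar> * ln (real (n + 3))) / real (n + 2) + (\<Sum>k<n+1. c k * x k) / real (n + 1)) \<longlonglongrightarrow> 0 + 0"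
  proof (rule tendsto_add)
    have "(\<lambda>n. x n * ((real n + 3) / real (n + 2) * (ln (real (n + 3)) / ln (real (n + 2))))) \<longlonglongrightarrow> 0 * 1"
      by (intro tendsto_mult x) real_asymp
    then show "(\<lambda>n. (real n + 3) * (\<bar>D (n + 2)\<bar> * ln (real (n + 3))) / real (n + 2)) \<longlonglongrightarrow> 0"
      using lnpos by (simp add: x_def mult_ac)
    have "(\<lambda>n. (\<Sum>k<n. c k * x k) / real n) \<longlonglongrightarrow> 0"
      using lnpos by (intro weighted_cesaro_tendsto_0[OF x _ sum_c]) (simp add: c_def less_imp_le)
    then show "(\<lambda>n. (\<Sum>k<n+1. c k * x k) / real (n + 1)) \<longlonglongrightarrow> 0"
      by (rule LIMSEQ_ignore_initial_segment)
  qed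
  have "(\<lambda>n. theta_diff P Q (n + 2) / real (n + 2)) \<longlonglongrightarrow> 0"
  proof (rule Lim_null_comparison[OF _ lim0[unfolded add_0]])
    show "eventually (\<lambda>n. norm (theta_diff P Q (n + 2) / real (n + 2)) \<le> (real n + 3) * (\<bar>D (n + 2)\<bar> * ln (real (n + 3))) / real (n + 2) + (\<Sum>k<n+1. c k * x k) / real (n + 1)) sequentially"
    proof (intro always_eventually allI)
      fix n
      have "0 \<le> (\<Sum>k<n+1. c k * x k)"
        using lnpos by (intro sum_nonneg mult_nonneg_nonneg) (auto simp: c_def x_def less_imp_le)
      then have "(\<Sum>k<n+1. c k * x k) / real (n + 2) \<le> (\<Sum>k<n+1. c k * x k) / real (n + 1)"
        by (intro divide_left_mono) auto
      moreover have "norm (theta_diff P Q (n + 2) / real (n + 2)) \<le> ((real n + 3) * (\<bar>D (n + 2)\<bar> * ln (real (n + 3))) + (\<Sum>k<n+1. c k * x k)) / real (n + 2)"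
        using divide_right_mono[OF main[of n], of "real (n + 2)"] by simp
      ultimately show "norm (theta_diff P Q (n + 2) / real (n + 2)) \<le> (real n + 3) * (\<bar>D (n + 2)\<bar> * ln (real (n + 3))) / real (n + 2) + (\<Sum>k<n+1. c k * x k) / real (n + 1)"
        by (simp add: add_divide_distrib)
    qed
  qed
  then show ?thesis by (rule LIMSEQ_offset)
qed

text \<open>A prime power with exponent at least 2 has its base at most \<open>sqrt n\<close>, and
  the powers of one \<open>p\<close> up to \<open>n\<close> contribute at most \<open>ln n\<close>.
  The sets \<open>E p\<close> keep the exponent 1, which only enlarges the majorant.\<close>

lemma mangoldt_nonprime_sum_le:
  assumes "n \<ge> 1"
  shows "(\<Sum>k\<in>{k\<in>{1..n}. \<not> prime k}. mangoldt k) \<le> sqrt (real n) * ln (real n)"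
proof -
  define B where "B = {p. prime p \<and> p * p \<le> n}"
  define E where "E = (\<lambda>p. {e. e \<ge> 1 \<and> p ^ e \<le> n})"
  have B_sub: "B \<subseteq> {1..nat \<lfloor>sqrt (real n)\<rfloor>}"
  proof
    fix p assume "p \<in> B"
    then have "real p * real p \<le> real n" "p \<ge> 1"
      by (auto simp: B_def prime_gt_0_nat Suc_le_eq simp flip: of_nat_mult)
    then have "real p \<le> sqrt (real n)" by (intro real_le_rsqrt) (simp add: power2_eq_square)
    then show "p \<in> {1..nat \<lfloor>sqrt (real n)\<rfloor>}" using \<open>p \<ge> 1\<close> by (simp add: le_nat_floor)
  qed
  then have finB: "finite B" by (rule finite_subset) simp
  have cardB: "real (card B) \<le> sqrt (real n)"
  proof -
    have "card B \<le> nat \<lfloor>sqrt (real n)\<rfloor>" using card_mono[OF _ B_sub] by simp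
    then have "real (card B) \<le> real (nat \<lfloor>sqrt (real n)\<rfloor>)" by (rule of_nat_mono)
    also have "\<dots> \<le> sqrt (real n)" by simp
    finally show ?thesis .
  qed
  have finE: "finite (E p)" and cardE: "real (card (E p)) * ln (real p) \<le> ln (real n)" if "prime p" for p
  proof -
    have p: "real p > 1" using prime_gt_1_nat[OF that] by simp
    then have lnp: "ln (real p) > 0" by simp
    have sub: "E p \<subseteq> {1..nat \<lfloor>ln (real n) / ln (real p)\<rfloor>}"
    proof
      fix e assume e: "e \<in> E p"
      then have "real p ^ e \<le> real n" by (auto simp: E_def simp flip: of_nat_power)
      then have "ln (real p ^ e) \<le> ln (real n)" using p assms by (subst ln_le_cancel_iff) auto
      then have "real e \<le> ln (real n) / ln (real p)"
        using lnp p by (simp add: ln_realpow field_simps)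
      then show "e \<in> {1..nat \<lfloor>ln (real n) / ln (real p)\<rfloor>}"
        using e by (simp add: E_def le_nat_floor)
    qed
    show "finite (E p)" using sub by (rule finite_subset) simp
    have "card (E p) \<le> nat \<lfloor>ln (real n) / ln (real p)\<rfloor>" using card_mono[OF _ sub] by simp
    then have "real (card (E p)) \<le> real (nat \<lfloor>ln (real n) / ln (real p)\<rfloor>)" by (rule of_nat_mono)
    also have "\<dots> \<le> ln (real n) / ln (real p)" using lnp assms by (intro of_nat_floor divide_nonneg_pos) auto
    finally show "real (card (E p)) * ln (real p) \<le> ln (real n)" using lnp by (simp add: field_simps)
  qed
  have fin: "finite (SIGMA p:B. E p)" using finB finE by (intro finite_SigmaI) (auto simp: B_def)
  have "(\<Sum>k\<in>{k\<in>{1..n}. \<not> prime k}. mangoldt k) = (\<Sum>k\<in>{k\<in>{1..n}. \<not> prime k \<and> primepow k}. mangoldt k :: real)"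
    by (rule sum.mono_neutral_right) (auto simp: mangoldt_def)
  also have "\<dots> \<le> (\<Sum>k\<in>(\<lambda>(p,e). p ^ e) ` (SIGMA p:B. E p). mangoldt k)"
  proof (rule sum_mono2)
    show "{k \<in> {1..n}. \<not> prime k \<and> primepow k} \<subseteq> (\<lambda>(p,e). p ^ e) ` (SIGMA p:B. E p)"
    proof
      fix k assume k: "k \<in> {k \<in> {1..n}. \<not> prime k \<and> primepow k}"
      then obtain p e where pe: "prime p" "e > 0" "k = p ^ e"
        by (auto simp: primepow_def)
      with k have "e \<noteq> 1" by auto
      then have "e \<ge> 2" using pe by simp
      then have "p ^ 2 \<le> p ^ e" using pe prime_gt_0_nat by (intro power_increasing) (auto simp: Suc_le_eq)
      then have "p \<in> B" using pe k by (simp add: B_def power2_eq_square)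
      moreover have "e \<in> E p" using pe k by (auto simp: E_def)
      ultimately show "k \<in> (\<lambda>(p,e). p ^ e) ` (SIGMA p:B. E p)" using pe by force
    qed
  qed (use fin in \<open>auto simp: mangoldt_nonneg\<close>)
  also have "\<dots> \<le> (\<Sum>(p,e)\<in>(SIGMA p:B. E p). mangoldt (p ^ e))"
    using sum_image_le[OF fin, of "mangoldt :: nat \<Rightarrow> real" "\<lambda>(p,e). p ^ e"]
    by (simp add: mangoldt_nonneg o_def case_prod_unfold)
  also have "\<dots> = (\<Sum>p\<in>B. \<Sum>e\<in>E p. mangoldt (p ^ e))"
    using finB finE by (subst sum.Sigma) (auto simp: B_def)
  also have "\<dots> = (\<Sum>p\<in>B. real (card (E p)) * ln (real p))"
    by (intro sum.cong refl) (simp add: B_def E_def)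
  also have "\<dots> \<le> (\<Sum>p\<in>B. ln (real n))"
    by (intro sum_mono cardE) (auto simp: B_def)
  also have "\<dots> \<le> sqrt (real n) * ln (real n)"
    using cardB assms by (simp add: mult_right_mono)
  finally show ?thesis .
qed

lemma gen_psi_diff_littleo:
  assumes "(\<lambda>n. weight_diff P Q n * ln (real n)) \<longlonglongrightarrow> 0"
  shows "(\<lambda>n. (gen_psi P n - gen_psi Q n) / real n) \<longlonglongrightarrow> 0"
proof -
  have bd: "\<bar>gen_psi P n - gen_psi Q n\<bar> \<le> \<bar>theta_diff P Q n\<bar> + sqrt (real n) * ln (real n)" if "n \<ge> 1" for n
  proof -
    have "gen_psi P n - gen_psi Q n = (\<Sum>k=1..n. (gen_ind P k - gen_ind Q k) * mangoldt k)"
      by (simp add: gen_psi_def sum_subtractf algebra_simps)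
    also have "\<dots> = (\<Sum>k=1..n. of_bool (prime k) * ((gen_ind P k - gen_ind Q k) * mangoldt k) + of_bool (\<not> prime k) * ((gen_ind P k - gen_ind Q k) * mangoldt k))"
      by (intro sum.cong) auto
    also have "\<dots> = theta_diff P Q n + (\<Sum>k=1..n. of_bool (\<not> prime k) * ((gen_ind P k - gen_ind Q k) * mangoldt k))"
      unfolding theta_diff_def sum.distrib
      by (intro arg_cong2[where f = "(+)"] sum.cong refl) (auto simp: gen_ind_def prime_prime_factors prime_gt_0_nat)
    also have "\<bar>\<dots>\<bar> \<le> \<bar>theta_diff P Q n\<bar> + \<bar>\<Sum>k=1..n. of_bool (\<not> prime k) * ((gen_ind P k - gen_ind Q k) * mangoldt k)\<bar>"
      by (rule abs_triangle_ineq)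
    also have "\<bar>\<Sum>k=1..n. of_bool (\<not> prime k) * ((gen_ind P k - gen_ind Q k) * mangoldt k)\<bar> \<le>
       (\<Sum>k=1..n. of_bool (\<not> prime k) * mangoldt k)"
      by (intro order.trans[OF sum_abs] sum_mono) (auto simp: abs_mult gen_ind_def mangoldt_nonneg)
    also have "\<dots> = (\<Sum>k\<in>{k\<in>{1..n}. \<not> prime k}. mangoldt k)"
      by (rule sum.mono_neutral_cong_right) auto
    also have "\<dots> \<le> sqrt (real n) * ln (real n)" by (rule mangoldt_nonprime_sum_le[OF that])
    finally show ?thesis by simp
  qed
  have "eventually (\<lambda>n. norm ((gen_psi P n - gen_psi Q n) / real n) \<le> \<bar>theta_diff P Q n / real n\<bar> + sqrt (real n) * ln (real n) / real n) sequentially"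
    using eventually_ge_at_top[of 1]
  proof eventually_elim
    case (elim n)
    show ?case using divide_right_mono[OF bd[OF elim], of "real n"] by (simp add: add_divide_distrib)
  qed
  moreover have "(\<lambda>n. \<bar>theta_diff P Q n / real n\<bar> + sqrt (real n) * ln (real n) / real n) \<longlonglongrightarrow> 0"
    by (rule tendsto_add_zero[OF tendsto_rabs_zero[OF theta_diff_littleo[OF assms]]]) real_asymp
  ultimately show ?thesis by (rule Lim_null_comparison)
qed

section \<open>Dirichlet series of two classes compared near s = 1\<close>

lemma minus_ln_one_minus_bounds:
  fixes x :: real
  assumes "0 \<le> x" "x \<le> 1 / 2"
  shows "x \<le> - ln (1 - x)" "- ln (1 - x) \<le> x + 2 * x ^ 2"
proof -
  show "x \<le> - ln (1 - x)" using ln_le_minus_one[of "1 - x"] assms by simp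
  have "- ln (1 - x) = ln (1 / (1 - x))" using assms by (simp add: ln_div)
  also have "\<dots> \<le> 1 / (1 - x) - 1" using assms by (intro ln_le_minus_one) auto
  also have "\<dots> \<le> x + 2 * x ^ 2"
  proof -
    have "0 \<le> x ^ 2 * (1 - 2 * x)" using assms by simp
    also have "x ^ 2 * (1 - 2 * x) = (x + 2 * x ^ 2 + 1) * (1 - x) - 1"
      by (simp add: algebra_simps power2_eq_square)
    finally show ?thesis using assms by (simp add: field_simps)
  qed
  finally show "- ln (1 - x) \<le> x + 2 * x ^ 2" .
qed

text \<open>The loads are formed at \<open>s = 1\<close>, the series compared at
  \<open>s = 1 + d\<close>. Replacing the weight at \<open>1 + d\<close> by
  \<open>k powr - d\<close> times the weight at 1 brings the loads back; this is the cost, summable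
  over \<open>k\<close> uniformly in \<open>d\<close>.\<close>

definition weight_error :: "real \<Rightarrow> nat \<Rightarrow> real" where
  "weight_error d k = prime_weight (1 + d) k - real k powr - d * prime_weight 1 k"

text \<open>With \<open>x = 1 / k\<close> and \<open>t = k powr - d \<le> 1\<close>, both terms of
  the difference lie between \<open>t * x\<close> and \<open>t * x + 2 * x ^ 2\<close>.\<close>

lemma abs_weight_error_le:
  assumes "d > 0"
  shows "\<bar>weight_error d k\<bar> \<le> 2 * real k powr - 2"
proof (cases "prime k")
  case True
  define x where "x = 1 / real k"
  define t where "t = real k powr - d"
  have k: "real k \<ge> 2" using prime_ge_2_nat[OF True] by simp
  have x: "0 \<le> x" "x \<le> 1 / 2" using k by (auto simp: x_def field_simps)
  have t: "0 \<le> t" "t \<le> 1" using k assms powr_less_one[of "real k" "-d"] by (auto simp: t_def)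
  have tx: "0 \<le> t * x" "t * x \<le> 1 / 2" using t x mult_mono[of t 1 x "1/2"] by auto
  have "real k powr - (1 + d) = t * x"
    using k by (simp add: t_def x_def powr_diff powr_minus powr_add field_simps)
  moreover have "real k powr - 1 = x" using k by (simp add: x_def powr_minus field_simps)
  ultimately have eq: "weight_error d k = - ln (1 - t * x) - t * (- ln (1 - x))"
    using True by (simp add: weight_error_def prime_weight_def t_def)
  have 1: "t * x \<le> - ln (1 - t * x)" "- ln (1 - t * x) \<le> t * x + 2 * (t * x) ^ 2"
    by (rule minus_ln_one_minus_bounds[OF tx])+
  have 2: "t * x \<le> t * (- ln (1 - x))" "t * (- ln (1 - x)) \<le> t * (x + 2 * x ^ 2)"
    using t minus_ln_one_minus_bounds[OF x] by (intro mult_left_mono; simp)+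
  have 3: "(t * x) ^ 2 \<le> x ^ 2" "t * x ^ 2 \<le> x ^ 2"
    using t x by (auto intro!: power_mono mult_left_le_one_le mult_nonneg_nonneg)
  have "x ^ 2 = real k powr - 2" using k by (simp add: x_def powr_minus powr_numeral field_simps)
  moreover have "t * (x + 2 * x ^ 2) = t * x + 2 * (t * x ^ 2)" by (simp add: algebra_simps)
  ultimately show ?thesis unfolding eq using 1 2 3 by linarith
qed (simp add: weight_error_def prime_weight_def)

lemma weight_error_tendsto_0: "((\<lambda>d. weight_error d k) \<longlongrightarrow> 0) (at_right 0)"
proof (cases "prime k")
  case True
  have k: "real k \<ge> 2" using prime_ge_2_nat[OF True] by simp
  have "((\<lambda>d. - ln (1 - real k powr - (1 + d)) - real k powr - d * (- ln (1 - real k powr - 1))) \<longlongrightarrow>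
     - ln (1 - real k powr - (1 + 0)) - real k powr - 0 * (- ln (1 - real k powr - 1))) (at_right 0)"
    using k by (intro tendsto_intros) (auto simp: powr_minus)
  then show ?thesis using True k by (simp add: weight_error_def prime_weight_def)
qed (simp add: weight_error_def prime_weight_def)

lemma sum_powr_by_parts:
  fixes g D :: "nat \<Rightarrow> real"
  shows "(\<Sum>k=1..n+1. g k * (D k - D (k - 1))) =
     (\<Sum>k<n. (g (k+1) - g (k+2)) * D (k+1)) + g (n+1) * D (n+1) - g 1 * D 0"
  by (induction n) (auto simp: algebra_simps)

lemma gen_series_pos: "s > 1 \<Longrightarrow> gen_series P s \<ge> 1"
  using sum_le_suminf[OF summable_gen_ind[of s P], of "{1}"] by (simp add: gen_series_def)

text \<open>The logarithm of the ratio is \<open>A d + B d\<close>. Summation by parts makes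
  \<open>A d\<close> an average of \<open>weight_diff\<close> with nonnegative weights of sum 1 that
  vanish individually as \<open>d\<close> tends to 0. \<open>B d\<close> collects the errors and
  vanishes by dominated convergence with majorant \<open>2 * k powr - 2\<close>.\<close>

lemma gen_series_ratio_tendsto:
  assumes D: "weight_diff P Q \<longlonglongrightarrow> 0"
  shows "((\<lambda>d. gen_series P (1 + d) / gen_series Q (1 + d)) \<longlongrightarrow> 1) (at_right 0)"
proof -
  define c where "c = (\<lambda>d k. real (k+1) powr - d - real (k+2) powr - d)"
  define u where "u = (\<lambda>k. of_bool (k \<in> P) - of_bool (k \<in> Q) :: real)"
  define A where "A = (\<lambda>d. \<Sum>k. c d k * weight_diff P Q (k + 1))"
  define B where "B = (\<lambda>d. \<Sum>k. u k * weight_error d k)"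
  have u: "\<bar>u k\<bar> \<le> 1" for k by (simp add: u_def)
  have c_nonneg: "c d k \<ge> 0" if "d > 0" for d k
    using that by (simp add: c_def powr_mono2')
  have c_sums: "c d sums 1" if "d > 0" for d
  proof -
    have "(\<lambda>k. real (k + 1) powr - d) \<longlonglongrightarrow> 0" using that by real_asymp
    from telescope_sums'[OF this] show ?thesis by (simp add: c_def)
  qed
  have A_sum: "(\<lambda>n. (\<Sum>k<n. c d k * weight_diff P Q (k + 1))) \<longlonglongrightarrow> A d" if "d > 0" for d
  proof -
    obtain K where K: "\<And>k. \<bar>weight_diff P Q k\<bar> \<le> K"
      using convergent_imp_Bseq[OF convergentI[OF D]] by (elim BseqE) auto
    have "summable (\<lambda>k. c d k * weight_diff P Q (k + 1))"
    proof (rule summable_comparison_test[OF _ summable_mult2[of "c d" K]])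
      show "\<exists>N. \<forall>n\<ge>N. norm (c d n * weight_diff P Q (n + 1)) \<le> c d n * K"
        using K c_nonneg[OF that] by (auto simp: abs_mult intro!: mult_left_mono)
      show "summable (c d)" using c_sums[OF that] by (simp add: sums_iff)
    qed
    then show ?thesis unfolding A_def by (rule summable_LIMSEQ)
  qed
  have A_lim: "(A \<longlongrightarrow> 0) (at_right 0)"
    unfolding A_def
  proof (rule toeplitz_tendsto_0[where C = 1])
    show "(\<lambda>k. weight_diff P Q (k + 1)) \<longlonglongrightarrow> 0" by (rule LIMSEQ_ignore_initial_segment[OF D])
    show "eventually (\<lambda>d. (\<forall>k. 0 \<le> c d k) \<and> summable (c d) \<and> suminf (c d) \<le> 1) (at_right 0)"
      using eventually_at_right_less[of 0]
      by eventually_elim (use c_sums c_nonneg in \<open>auto simp: sums_iff\<close>)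
    fix k
    have "((\<lambda>d. c d k) \<longlongrightarrow> real (k+1) powr - 0 - real (k+2) powr - 0) (at_right 0)"
      unfolding c_def by (intro tendsto_intros) auto
    then show "((\<lambda>d. c d k) \<longlongrightarrow> 0) (at_right 0)" by simp
  qed
  have err: "norm (u k * weight_error d k) \<le> 2 * real k powr - 2" if "d > 0" for d k
    using mult_mono[OF u[of k] abs_weight_error_le[OF that, of k]] by (simp add: abs_mult)
  have summ2: "summable (\<lambda>k. 2 * real k powr - 2)"
    by (intro summable_mult) (simp add: summable_real_powr_iff)
  have B_lim: "(B \<longlongrightarrow> 0) (at_right 0)"
  proof -
    have "eventually (\<lambda>(k, d). norm (u k * weight_error d k) \<le> 2 * real k powr - 2) (at_top \<times>\<^sub>F at_right 0)"
      using eventually_prodI[OF always_eventually[of "\<lambda>_. True"] eventually_at_right_less[of 0]]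
      by (rule eventually_mono) (use err in auto)
    moreover have "((\<lambda>d. u k * weight_error d k) \<longlongrightarrow> 0) (at_right 0)" for k
      by (intro tendsto_mult_right_zero weight_error_tendsto_0)
    ultimately show ?thesis
      using tannerys_theorem[of "\<lambda>k d. u k * weight_error d k" "\<lambda>_. 0" "at_right 0" "\<lambda>k. 2 * real k powr - 2"] summ2
      by (simp add: B_def)
  qed
  have B_sum: "(\<lambda>n. \<Sum>k\<le>n. u k * weight_error d k) \<longlonglongrightarrow> B d" if "d > 0" for d
    unfolding B_def by (intro summable_LIMSEQ' summable_comparison_test[OF _ summ2]) (use err[OF that] in auto)
  have ratio: "gen_series P (1 + d) / gen_series Q (1 + d) = exp (A d + B d)" if d: "d > 0" for d
  proof (rule LIMSEQ_unique)
    let ?S = "\<lambda>P N. \<Sum>k=1..N. of_bool (k \<in> P) * prime_weight (1 + d) k"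
    have "(\<lambda>N. exp (?S P N) / exp (?S Q N)) \<longlonglongrightarrow> gen_series P (1 + d) / gen_series Q (1 + d)"
      using d gen_series_pos[of "1 + d" Q] by (intro tendsto_divide euler_product_tendsto) auto
    then show "(\<lambda>n. exp (?S P (n + 1)) / exp (?S Q (n + 1))) \<longlonglongrightarrow> gen_series P (1 + d) / gen_series Q (1 + d)"
      by (rule LIMSEQ_ignore_initial_segment)
    have eq: "exp (?S P (n + 1)) / exp (?S Q (n + 1)) =
        exp ((\<Sum>k<n. c d k * weight_diff P Q (k + 1)) + real (n + 1) powr - d * weight_diff P Q (n + 1) + (\<Sum>k\<le>n+1. u k * weight_error d k))" for n
    proof -
      have "?S P (n + 1) - ?S Q (n + 1) = (\<Sum>k=1..n+1. u k * prime_weight (1 + d) k)"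
        by (simp only: sum_subtractf[symmetric] u_def left_diff_distrib)
      also have "\<dots> = (\<Sum>k=1..n+1. real k powr - d * (weight_diff P Q k - weight_diff P Q (k - 1))) + (\<Sum>k=1..n+1. u k * weight_error d k)"
        unfolding sum.distrib[symmetric]
      proof (intro sum.cong refl)
        fix k assume "k \<in> {1..n+1}"
        then obtain j where "k = Suc j" by (cases k) auto
        then have "weight_diff P Q k - weight_diff P Q (k - 1) = u k * prime_weight 1 k"
          by (simp add: weight_diff_def u_def)
        then show "u k * prime_weight (1 + d) k = real k powr - d * (weight_diff P Q k - weight_diff P Q (k - 1)) + u k * weight_error d k"
          by (simp add: weight_error_def algebra_simps)
      qed
      also have "(\<Sum>k=1..n+1. real k powr - d * (weight_diff P Q k - weight_diff P Q (k - 1))) =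
         (\<Sum>k<n. c d k * weight_diff P Q (k + 1)) + real (n + 1) powr - d * weight_diff P Q (n + 1)"
      proof -
        have "weight_diff P Q 0 = 0" by (simp add: weight_diff_def)
        then show ?thesis
          using sum_powr_by_parts[of "\<lambda>k. real k powr - d" "weight_diff P Q" n]
          by (simp add: c_def del: sum.cl_ivl_Suc)
      qed
      also have "(\<Sum>k=1..n+1. u k * weight_error d k) = (\<Sum>k\<le>n+1. u k * weight_error d k)"
        by (rule sum.mono_neutral_left) (auto simp: weight_error_def prime_weight_def not_le)
      finally show ?thesis by (simp flip: exp_diff)
    qed
    have "(\<lambda>n. real (n + 1) powr - d) \<longlonglongrightarrow> 0" using d by real_asymp
    then have "(\<lambda>n. real (n + 1) powr - d * weight_diff P Q (n + 1)) \<longlonglongrightarrow> 0 * 0"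
      by (intro tendsto_mult LIMSEQ_ignore_initial_segment[OF D])
    then have "(\<lambda>n. exp ((\<Sum>k<n. c d k * weight_diff P Q (k + 1)) + real (n + 1) powr - d * weight_diff P Q (n + 1) + (\<Sum>k\<le>n+1. u k * weight_error d k))) \<longlonglongrightarrow> exp (A d + 0 * 0 + B d)"
      by (intro tendsto_exp tendsto_add A_sum[OF d] LIMSEQ_ignore_initial_segment[OF B_sum[OF d]])
    then show "(\<lambda>n. exp (?S P (n + 1)) / exp (?S Q (n + 1))) \<longlonglongrightarrow> exp (A d + B d)"
      unfolding eq by simp
  qed
  have "((\<lambda>d. exp (A d + B d)) \<longlongrightarrow> exp (0 + 0)) (at_right 0)"
    by (intro tendsto_intros A_lim B_lim)
  then have "((\<lambda>d. exp (A d + B d)) \<longlongrightarrow> 1) (at_right 0)" by simp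
  then show ?thesis
    by (rule Lim_transform_eventually) (use eventually_at_right_less[of 0] in eventually_elim, simp add: ratio)
qed

section \<open>The pole of the zeta function at s = 1\<close>

lemma powr_diff_bounds:
  fixes x d :: real
  assumes "x > 0" "d > 0"
  shows "d * (x + 1) powr - (1 + d) \<le> x powr - d - (x + 1) powr - d"
    "x powr - d - (x + 1) powr - d \<le> d * x powr - (1 + d)"
proof -
  have "\<exists>z>x. z < x + 1 \<and> (x + 1) powr - d - x powr - d = (x + 1 - x) * (- d * z powr (- d - 1))"
    using assms by (intro MVT2) (auto intro!: derivative_eq_intros simp: powr_diff)
  then obtain z where z: "x < z" "z < x + 1" "(x + 1) powr - d - x powr - d = (x + 1 - x) * (- d * z powr (- d - 1))"
    by blast
  have "- d - 1 = - (1 + d)" by simp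
  then have eq: "x powr - d - (x + 1) powr - d = d * z powr - (1 + d)"
    using z(3) by (simp only: minus_diff_eq[of "(x + 1) powr - d", symmetric]) simp
  show "d * (x + 1) powr - (1 + d) \<le> x powr - d - (x + 1) powr - d"
    "x powr - d - (x + 1) powr - d \<le> d * x powr - (1 + d)"
    unfolding eq using z assms by (auto intro!: mult_left_mono powr_mono2')
qed

text \<open>The differences \<open>k powr - d - (k + 1) powr - d\<close> telescope to 1 and lie
  between \<open>d\<close> times two consecutive terms of the series, so \<open>d\<close> times the
  series lies between 1 and \<open>1 + d\<close>.\<close>

lemma zeta_tendsto: "((\<lambda>d. d * gen_series UNIV (1 + d)) \<longlongrightarrow> 1) (at_right 0)"
proof (rule tendsto_sandwich)
  have bounds: "1 \<le> d * gen_series UNIV (1 + d) \<and> d * gen_series UNIV (1 + d) \<le> 1 + d" if d: "d > 0" for d :: real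
  proof -
    let ?g = "\<lambda>k. real (k + 1) powr - (1 + d)"
    have lim: "(\<lambda>k. real (k + 1) powr - d) \<longlonglongrightarrow> 0" using d by real_asymp
    have tel: "(\<lambda>k. real (k + 1) powr - d - real (k + 2) powr - d) sums 1"
      using telescope_sums'[OF lim] by simp
    have sg: "summable ?g"
      using d summable_real_powr_iff[of "- (1 + d)"] summable_ignore_initial_segment[of "\<lambda>n. real n powr - (1 + d)" 1] by simp
    have eq: "gen_series UNIV (1 + d) = suminf ?g"
    proof -
      have "(\<lambda>n. gen_ind UNIV n * real n powr - (1 + d)) sums gen_series UNIV (1 + d)"
        unfolding gen_series_def using d by (intro summable_sums summable_gen_ind) auto
      from this[THEN sums_split_initial_segment, of 1] show ?thesis
        by (simp add: sums_iff gen_ind_def)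
    qed
    have Suc2: "real (k + 2) = real (k + 1) + 1" for k by simp
    have le: "real (k + 1) powr - d - real (k + 2) powr - d \<le> d * ?g k"
       "d * ?g (k + 1) \<le> real (k + 1) powr - d - real (k + 2) powr - d" for k
      using powr_diff_bounds[of "real (k + 1)" d] d unfolding Suc2 by simp_all
    have "1 \<le> (\<Sum>k. d * ?g k)"
      using suminf_le[OF le(1) sums_summable[OF tel] summable_mult[OF sg]] sums_unique[OF tel] by simp
    then have 1: "1 \<le> d * suminf ?g" using suminf_mult[OF sg] by simp
    have s1: "summable (\<lambda>k. ?g (k + 1))" by (rule summable_ignore_initial_segment[OF sg])
    have "(\<Sum>k. d * ?g (k + 1)) \<le> 1"
      using suminf_le[OF le(2) summable_mult[OF s1] sums_summable[OF tel]] sums_unique[OF tel] by simp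
    then have "d * (\<Sum>k. ?g (k + 1)) \<le> 1" using suminf_mult[OF s1] by simp
    moreover have "suminf ?g = (\<Sum>k. ?g (k + 1)) + 1"
      using suminf_split_initial_segment[OF sg, of 1] by simp
    ultimately show ?thesis unfolding eq using 1 by (simp add: algebra_simps)
  qed
  show "eventually (\<lambda>d. 1 \<le> d * gen_series UNIV (1 + d)) (at_right 0)"
    using eventually_at_right_less[of 0] by eventually_elim (use bounds in auto)
  show "eventually (\<lambda>d. d * gen_series UNIV (1 + d) \<le> 1 + d) (at_right 0)"
    using eventually_at_right_less[of 0] by eventually_elim (use bounds in auto)
  show "((\<lambda>d::real. 1 + d) \<longlongrightarrow> 1) (at_right 0)" by (auto intro!: tendsto_eq_intros)
qed auto

section \<open>The multiplicative basis\<close>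

text \<open>Up to O(N), \<open>S N * ln N\<close> is the sum of \<open>f n * ln n\<close>, hence of
  \<open>f m * gen_psi P (N div m)\<close>. Replacing \<open>gen_psi P\<close> by
  \<open>\<tau> * psi\<close> costs an arbitrarily small multiple of \<open>N * LL N\<close> plus
  O(N), and what remains is \<open>\<tau> * N * LL N + O(N)\<close>. Division by
  \<open>N * ln N powr \<tau>\<close> removes every O(N).\<close>

lemma gen_ind_count_asymptotics:
  fixes \<tau> \<kappa> :: real
  assumes \<tau>: "\<tau> > 0"
    and L: "(\<lambda>N. (\<Sum>n=1..N. gen_ind P n / real n) / ln (real N) powr \<tau>) \<longlonglongrightarrow> \<kappa>"
    and E: "(\<lambda>n. (gen_psi P n - \<tau> * psi n) / real n) \<longlonglongrightarrow> 0"
  shows "(\<lambda>N. (\<Sum>n=1..N. gen_ind P n) * (ln (real N) powr (1 - \<tau>) / real N)) \<longlonglongrightarrow> \<tau> * \<kappa>"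
proof -
  define S where "S = (\<lambda>N. \<Sum>n=1..N. gen_ind P n)"
  define LL where "LL = (\<lambda>N. \<Sum>n=1..N. gen_ind P n / real n)"
  define c :: real where "c = 1 + euler_mascheroni"
  have c: "c \<ge> 0" using euler_mascheroni_pos by (simp add: c_def)
  have S: "0 \<le> S N" "S N \<le> real N" for N
    using sum_mono[of "{1..N}" "gen_ind P" "\<lambda>_. 1"] by (auto simp: S_def intro!: sum_nonneg)
  have L0: "0 \<le> LL N" for N by (auto simp: LL_def intro!: sum_nonneg)
  \<comment> \<open>The sum of \<open>f n * ln (N / n)\<close> is at most its value for f = 1, which
    is \<open>ln (N ^ N / fact N)\<close>; that quotient is a single term of the series for
    \<open>exp N\<close>.\<close>
  have log_part: "0 \<le> S N * ln (real N) - (\<Sum>n=1..N. gen_ind P n * ln (real n))"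
    "S N * ln (real N) - (\<Sum>n=1..N. gen_ind P n * ln (real n)) \<le> real N" if "N > 0" for N
  proof -
    have eq: "S N * ln (real N) - (\<Sum>n=1..N. gen_ind P n * ln (real n)) = (\<Sum>n=1..N. gen_ind P n * (ln (real N) - ln (real n)))"
      by (simp add: S_def sum_distrib_right sum_subtractf right_diff_distrib)
    have nn: "0 \<le> ln (real N) - ln (real n)" if "n \<in> {1..N}" for n using that by simp
    show "0 \<le> S N * ln (real N) - (\<Sum>n=1..N. gen_ind P n * ln (real n))"
      unfolding eq by (intro sum_nonneg mult_nonneg_nonneg nn) auto
    have "(\<Sum>n=1..N. gen_ind P n * (ln (real N) - ln (real n))) \<le> (\<Sum>n=1..N. ln (real N) - ln (real n))"
      by (intro sum_mono mult_left_le_one_le nn) auto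
    also have "\<dots> = real N * ln (real N) - ln (fact N)"
      by (simp add: sum_subtractf ln_fact_eq_sum_ln)
    also have "\<dots> \<le> real N"
    proof -
      have "(\<Sum>k\<le>N. inverse (fact k) * real N ^ k) \<le> exp (real N)"
        using exp_converges[of "real N"] sum_le_suminf[of "\<lambda>k. inverse (fact k) * real N ^ k" "{..N}"]
        by (simp add: sums_iff)
      moreover have "inverse (fact N) * real N ^ N \<le> (\<Sum>k\<le>N. inverse (fact k) * real N ^ k)"
        by (intro member_le_sum) auto
      ultimately have "ln (inverse (fact N) * real N ^ N) \<le> ln (exp (real N))"
        using that by (subst ln_le_cancel_iff) auto
      then show ?thesis using that by (simp add: ln_mult ln_inverse ln_realpow)
    qed
    finally show "S N * ln (real N) - (\<Sum>n=1..N. gen_ind P n * ln (real n)) \<le> real N"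
      unfolding eq .
  qed
  have psi_part: "\<bar>(\<Sum>m=1..N. gen_ind P m * psi (N div m)) - real N * LL N\<bar> \<le> (4 + c) * real N" for N
  proof -
    have "(\<Sum>m=1..N. gen_ind P m * (psi (N div m) - real N / real m + c)) =
       (\<Sum>m=1..N. gen_ind P m * psi (N div m)) - real N * LL N + c * S N"
      by (simp add: LL_def S_def sum.distrib sum_subtractf sum_distrib_left algebra_simps)
    moreover have "\<bar>\<Sum>m=1..N. gen_ind P m * (psi (N div m) - real N / real m + c)\<bar> \<le> 4 * real N"
      unfolding c_def by (rule sum_gen_ind_psi_bound)
    moreover have "c * S N \<le> c * real N" "0 \<le> c * S N" using c S by (auto intro: mult_left_mono)
    ultimately show ?thesis by (simp add: algebra_simps)
  qed
  have approx: "\<exists>C. \<forall>N>0. \<bar>S N * ln (real N) - \<tau> * (real N * LL N)\<bar> \<le> e * (real N * LL N) + C * real N"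
    if "e > 0" for e
  proof -
    obtain M where M: "\<And>n. n \<ge> M \<Longrightarrow> \<bar>(gen_psi P n - \<tau> * psi n) / real n\<bar> < e"
      using tendstoD[OF E \<open>e > 0\<close>] by (auto simp: eventually_at_top_linorder)
    \<comment> \<open>\<open>N div m\<close> is small for most \<open>m\<close>, where the
      asymptotic bound is not yet valid. The constant \<open>K\<close> absorbs these finitely many
      values and costs only \<open>K * N\<close> in the sum over \<open>m\<close>.\<close>
    define K where "K = (\<Sum>n<M. \<bar>gen_psi P n - \<tau> * psi n\<bar>)"
    have "K \<ge> 0" by (auto simp: K_def)
    have err: "\<bar>gen_psi P n - \<tau> * psi n\<bar> \<le> e * real n + K" for n
    proof (cases "n < M")
      case True
      then have "\<bar>gen_psi P n - \<tau> * psi n\<bar> \<le> K" unfolding K_def by (intro member_le_sum) auto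
      then show ?thesis using \<open>e > 0\<close> by (simp add: add_increasing)
    next
      case False
      show ?thesis
      proof (cases "n = 0")
        case True
        then show ?thesis using \<open>K \<ge> 0\<close> by (simp add: gen_psi_def psi_def)
      next
        case nz: False
        then show ?thesis using M[of n] False \<open>K \<ge> 0\<close> by (simp add: abs_divide divide_less_eq)
      qed
    qed
    have "\<bar>S N * ln (real N) - \<tau> * (real N * LL N)\<bar> \<le> e * (real N * LL N) + (1 + \<tau> * (4 + c) + K) * real N"
      if "N > 0" for N
    proof -
      have "(\<Sum>n=1..N. gen_ind P n * ln (real n)) =
        \<tau> * (\<Sum>m=1..N. gen_ind P m * psi (N div m)) + (\<Sum>m=1..N. gen_ind P m * (gen_psi P (N div m) - \<tau> * psi (N div m)))"
        unfolding sum_gen_ind_ln by (simp add: sum_distrib_left sum_subtractf algebra_simps)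
      moreover have "\<bar>\<Sum>m=1..N. gen_ind P m * (gen_psi P (N div m) - \<tau> * psi (N div m))\<bar> \<le> e * (real N * LL N) + K * real N"
      proof -
        have "\<bar>\<Sum>m=1..N. gen_ind P m * (gen_psi P (N div m) - \<tau> * psi (N div m))\<bar> \<le>
          (\<Sum>m=1..N. gen_ind P m * (e * (real N / real m) + K))"
        proof (intro order.trans[OF sum_abs] sum_mono)
          fix m assume "m \<in> {1..N}"
          have "\<bar>gen_psi P (N div m) - \<tau> * psi (N div m)\<bar> \<le> e * real (N div m) + K" by (rule err)
          also have "\<dots> \<le> e * (real N / real m) + K"
            using \<open>e > 0\<close> by (intro add_right_mono mult_left_mono of_nat_div_le_of_nat) auto
          finally show "\<bar>gen_ind P m * (gen_psi P (N div m) - \<tau> * psi (N div m))\<bar> \<le> gen_ind P m * (e * (real N / real m) + K)"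
            by (simp add: abs_mult mult_left_mono)
        qed
        also have "\<dots> = e * (real N * LL N) + K * S N"
          by (simp add: LL_def S_def sum.distrib sum_distrib_left algebra_simps)
        also have "\<dots> \<le> e * (real N * LL N) + K * real N"
          using S[of N] \<open>K \<ge> 0\<close> by (simp add: mult_left_mono)
        finally show ?thesis .
      qed
      moreover have "\<bar>\<tau> * (\<Sum>m=1..N. gen_ind P m * psi (N div m)) - \<tau> * (real N * LL N)\<bar> \<le> \<tau> * ((4 + c) * real N)"
        using psi_part[of N] \<tau> by (simp add: abs_mult flip: right_diff_distrib)
      moreover have "(1 + \<tau> * (4 + c) + K) * real N = real N + \<tau> * ((4 + c) * real N) + K * real N"
        by (simp add: algebra_simps)
      ultimately show ?thesis using log_part[OF that] by linarith
    qed
    then show ?thesis by blast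
  qed
  have "(\<lambda>N. S N * (ln (real N) powr (1 - \<tau>) / real N) - \<tau> * (LL N / ln (real N) powr \<tau>)) \<longlonglongrightarrow> 0"
  proof (rule tendstoI)
    fix \<epsilon> :: real assume "\<epsilon> > 0"
    define e where "e = \<epsilon> / (2 * (\<bar>\<kappa>\<bar> + 1))"
    have D: "\<bar>\<kappa>\<bar> + 1 > 0" by linarith
    have e: "e > 0" "e * (\<bar>\<kappa>\<bar> + 1) = \<epsilon> / 2"
    proof -
      show "e > 0" unfolding e_def using \<open>\<epsilon> > 0\<close> D by (intro divide_pos_pos) auto
      have "\<epsilon> / (2 * z) * z = \<epsilon> / 2" if "z > 0" for z using that by simp
      then show "e * (\<bar>\<kappa>\<bar> + 1) = \<epsilon> / 2" using D unfolding e_def by blast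
    qed
    obtain C where C: "\<And>N. N > 0 \<Longrightarrow> \<bar>S N * ln (real N) - \<tau> * (real N * LL N)\<bar> \<le> e * (real N * LL N) + C * real N"
      using approx[OF e(1)] by blast
    have "eventually (\<lambda>N. LL N / ln (real N) powr \<tau> < \<bar>\<kappa>\<bar> + 1) sequentially"
      using L by (intro order_tendstoD(2)[of _ \<kappa>]) (auto simp: LL_def)
    moreover have "(\<lambda>N. C / ln (real N) powr \<tau>) \<longlonglongrightarrow> 0" using \<tau> by real_asymp
    then have "eventually (\<lambda>N. C / ln (real N) powr \<tau> < \<epsilon> / 2) sequentially"
      using \<open>\<epsilon> > 0\<close> by (intro order_tendstoD(2)) auto
    ultimately show "eventually (\<lambda>N. dist (S N * (ln (real N) powr (1 - \<tau>) / real N) - \<tau> * (LL N / ln (real N) powr \<tau>)) 0 < \<epsilon>) sequentially"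
      using eventually_gt_at_top[of 1]
    proof eventually_elim
      case (elim N)
      define l where "l = ln (real N) powr \<tau>"
      have ln: "ln (real N) > 0" using elim by simp
      then have l: "l > 0" by (simp add: l_def)
      have N: "real N > 0" using elim by simp
      have pw: "ln (real N) powr (1 - \<tau>) = ln (real N) / l"
        using ln by (simp add: l_def powr_diff)
      have "S N * (ln (real N) powr (1 - \<tau>) / real N) - \<tau> * (LL N / l) =
         (S N * ln (real N) - \<tau> * (real N * LL N)) / (real N * l)"
        unfolding pw using N l by (simp add: field_simps)
      also have "\<bar>\<dots>\<bar> \<le> (e * (real N * LL N) + C * real N) / (real N * l)"
        using C[of N] N l by (simp add: abs_divide abs_mult divide_right_mono)
      also have "\<dots> = e * (LL N / l) + C / l" using N l by (simp add: field_simps)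
      also have "e * (LL N / l) \<le> e * (\<bar>\<kappa>\<bar> + 1)"
        using elim(1) e(1) by (intro mult_left_mono) (auto simp: l_def)
      also have "e * (\<bar>\<kappa>\<bar> + 1) + C / l < \<epsilon>" unfolding l_def using e(2) elim(2) by linarith
      finally show ?case by (simp add: l_def dist_real_def)
    qed
  qed
  moreover have "(\<lambda>N. \<tau> * (LL N / ln (real N) powr \<tau>)) \<longlonglongrightarrow> \<tau> * \<kappa>"
    using L unfolding LL_def by (intro tendsto_mult_left)
  ultimately have "(\<lambda>N. S N * (ln (real N) powr (1 - \<tau>) / real N) - \<tau> * (LL N / ln (real N) powr \<tau>) + \<tau> * (LL N / ln (real N) powr \<tau>)) \<longlonglongrightarrow> 0 + \<tau> * \<kappa>"
    by (rule tendsto_add)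
  then show ?thesis by (simp add: S_def)
qed

text \<open>Karamata's theorem for masses \<open>f n / n\<close> at the points \<open>ln n\<close>:
  the Laplace transform at \<open>d\<close> is the Dirichlet series at \<open>1 + d\<close>, and
  \<open>T = ln N\<close>.\<close>

lemma gen_ind_harmonic_asymptotics:
  fixes \<tau> :: real
  assumes \<tau>: "\<tau> > 0"
    and lim: "((\<lambda>d. d powr \<tau> * gen_series P (1 + d)) \<longlongrightarrow> 1) (at_right 0)"
  shows "(\<lambda>N. (\<Sum>n=1..N. gen_ind P n / real n) / ln (real N) powr \<tau>) \<longlonglongrightarrow> 1 / Gamma (\<tau> + 1)"
proof -
  have eq: "gen_ind P n / real n * exp (- d * ln (real n)) = gen_ind P n * real n powr - (1 + d)" for n d
    by (cases "n = 0") (auto simp: powr_def ring_distribs exp_diff exp_minus field_simps)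
  have "((\<lambda>T. (\<Sum>n. gen_ind P n / real n * of_bool (ln (real n) \<le> T)) / T powr \<tau>) \<longlongrightarrow> 1 / Gamma (\<tau> + 1)) at_top"
  proof (rule karamata[OF \<tau>])
    fix n :: nat
    show "gen_ind P n / real n \<ge> 0" by simp
    \<comment> \<open>At \<open>n = 0\<close> this rests on the default value
      \<open>ln 0 = 0\<close>; the mass there is 0.\<close>
    show "ln (real n) \<ge> 0" by (cases "n = 0") auto
  next
    fix d :: real assume "d > 0"
    then show "summable (\<lambda>n. gen_ind P n / real n * exp (- d * ln (real n)))"
      unfolding eq by (intro summable_gen_ind) simp
  next
    show "((\<lambda>d. d powr \<tau> * (\<Sum>n. gen_ind P n / real n * exp (- d * ln (real n)))) \<longlongrightarrow> 1) (at_right 0)"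
      unfolding eq using lim by (simp add: gen_series_def)
  qed
  then have "(\<lambda>N::nat. (\<Sum>n. gen_ind P n / real n * of_bool (ln (real n) \<le> ln (real N))) / ln (real N) powr \<tau>) \<longlonglongrightarrow> 1 / Gamma (\<tau> + 1)"
    by (rule filterlim_compose) real_asymp
  then show ?thesis
  proof (rule Lim_transform_eventually)
    show "eventually (\<lambda>N. (\<Sum>n. gen_ind P n / real n * of_bool (ln (real n) \<le> ln (real N))) / ln (real N) powr \<tau> =
      (\<Sum>n=1..N. gen_ind P n / real n) / ln (real N) powr \<tau>) sequentially"
      using eventually_gt_at_top[of 0]
    proof eventually_elim
      case (elim N)
      have "(\<Sum>n. gen_ind P n / real n * of_bool (ln (real n) \<le> ln (real N))) = (\<Sum>n=1..N. gen_ind P n / real n * of_bool (ln (real n) \<le> ln (real N)))"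
        using elim by (intro suminf_finite) (auto simp: not_le gen_ind_def)
      also have "\<dots> = (\<Sum>n=1..N. gen_ind P n / real n)"
        using elim by (intro sum.cong) auto
      finally show ?case by simp
    qed
  qed
qed

section \<open>Partition of the primes into \<open>h\<close> balanced classes\<close>

context
  fixes h :: nat and P :: "nat \<Rightarrow> nat set"
  assumes h: "h > 0"
    and cover: "\<And>k. \<exists>i<h. k \<in> P i"
    and disj: "\<And>i j k. i < h \<Longrightarrow> j < h \<Longrightarrow> k \<in> P i \<Longrightarrow> k \<in> P j \<Longrightarrow> i = j"
    and balance: "\<And>i j. i < h \<Longrightarrow> j < h \<Longrightarrow> (\<lambda>n. weight_diff (P i) (P j) n * ln (real n)) \<longlonglongrightarrow> 0"
begin

lemma sum_of_bool_partition: "(\<Sum>i<h. of_bool (k \<in> P i)) = (1 :: real)"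
proof -
  obtain i where i: "i < h" "k \<in> P i" using cover by blast
  have "k \<in> P j \<longleftrightarrow> j = i" if "j < h" for j
    using disj[OF that i(1) _ i(2)] i(2) by blast
  then have "(\<Sum>j<h. of_bool (k \<in> P j)) = (\<Sum>j<h. of_bool (j = i) :: real)"
    by (intro sum.cong) auto
  then show ?thesis using i by simp
qed

lemma weight_diff_tendsto_0:
  assumes "i < h" "j < h"
  shows "weight_diff (P i) (P j) \<longlonglongrightarrow> 0"
proof (rule Lim_null_comparison[OF _ tendsto_rabs_zero[OF balance[OF assms]]])
  have "eventually (\<lambda>n::nat. ln (real n) \<ge> 1) sequentially" by real_asymp
  then show "eventually (\<lambda>n. norm (weight_diff (P i) (P j) n) \<le> \<bar>weight_diff (P i) (P j) n * ln (real n)\<bar>) sequentially"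
  proof eventually_elim
    case (elim n)
    show ?case using mult_left_mono[OF elim, of "\<bar>weight_diff (P i) (P j) n\<bar>"] elim by (simp add: abs_mult)
  qed
qed

lemma prod_gen_series:
  assumes "s > 1"
  shows "(\<Prod>i<h. gen_series (P i) s) = gen_series UNIV s"
proof (rule LIMSEQ_unique)
  let ?S = "\<lambda>P N. \<Sum>k=1..N. of_bool (k \<in> P) * prime_weight s k"
  show "(\<lambda>N. \<Prod>i<h. exp (?S (P i) N)) \<longlonglongrightarrow> (\<Prod>i<h. gen_series (P i) s)"
    by (intro tendsto_prod euler_product_tendsto assms)
  have "(\<Sum>i<h. ?S (P i) N) = ?S UNIV N" for N
  proof -
    have "(\<Sum>i<h. ?S (P i) N) = (\<Sum>k=1..N. (\<Sum>i<h. of_bool (k \<in> P i)) * prime_weight s k)"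
      unfolding sum_distrib_right by (rule sum.swap)
    then show ?thesis by (simp only: sum_of_bool_partition) simp
  qed
  then have "(\<Prod>i<h. exp (?S (P i) N)) = exp (?S UNIV N)" for N
    by (simp only: exp_sum[symmetric] finite_lessThan)
  then show "(\<lambda>N. \<Prod>i<h. exp (?S (P i) N)) \<longlonglongrightarrow> gen_series UNIV s"
    using euler_product_tendsto[OF assms, of UNIV] by simp
qed

text \<open>The zeta function is the product of all class series, so multiplying it by the ratios of
  the series of \<open>P i\<close> to those of all \<open>P j\<close> leaves the \<open>h\<close>-th
  power of the series of \<open>P i\<close>. The ratios tend to 1 and the pole of zeta is simple; an
  \<open>h\<close>-th root finishes.\<close>

lemma gen_series_asymptotics:
  assumes i: "i < h"
  shows "((\<lambda>d. d powr (1 / real h) * gen_series (P i) (1 + d)) \<longlongrightarrow> 1) (at_right 0)"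
proof -
  have "((\<lambda>d. d * gen_series UNIV (1 + d) * (\<Prod>j<h. gen_series (P i) (1 + d) / gen_series (P j) (1 + d))) \<longlongrightarrow> 1 * (\<Prod>j<h. 1)) (at_right 0)"
    by (rule tendsto_mult[OF zeta_tendsto tendsto_prod[OF gen_series_ratio_tendsto]])
       (use weight_diff_tendsto_0 i in auto)
  then have "((\<lambda>d. (d * gen_series UNIV (1 + d) * (\<Prod>j<h. gen_series (P i) (1 + d) / gen_series (P j) (1 + d))) powr (1 / real h)) \<longlongrightarrow> 1 powr (1 / real h)) (at_right 0)"
    by (intro tendsto_powr tendsto_const) auto
  then have "((\<lambda>d. (d * gen_series UNIV (1 + d) * (\<Prod>j<h. gen_series (P i) (1 + d) / gen_series (P j) (1 + d))) powr (1 / real h)) \<longlongrightarrow> 1) (at_right 0)"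
    by simp
  then show ?thesis
  proof (rule Lim_transform_eventually)
    show "eventually (\<lambda>d. (d * gen_series UNIV (1 + d) * (\<Prod>j<h. gen_series (P i) (1 + d) / gen_series (P j) (1 + d))) powr (1 / real h)
      = d powr (1 / real h) * gen_series (P i) (1 + d)) (at_right 0)"
      using eventually_at_right_less[of 0]
    proof eventually_elim
      case (elim d)
      have pos: "gen_series (P j) (1 + d) > 0" for j using gen_series_pos[of "1 + d" "P j"] elim by linarith
      have "(\<Prod>j<h. gen_series (P j) (1 + d)) \<noteq> 0"
        using pos by (auto simp: less_le)
      then have "gen_series UNIV (1 + d) * (\<Prod>j<h. gen_series (P i) (1 + d) / gen_series (P j) (1 + d)) = gen_series (P i) (1 + d) ^ h"
        using prod_gen_series[of "1 + d"] elim by (simp add: prod_dividef)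
      then have eq: "d * gen_series UNIV (1 + d) * (\<Prod>j<h. gen_series (P i) (1 + d) / gen_series (P j) (1 + d)) = d * gen_series (P i) (1 + d) powr real h"
        using pos by (simp add: powr_realpow mult.assoc)
      show ?case unfolding eq using elim h pos[of i] by (simp add: powr_mult powr_powr)
    qed
  qed
qed

lemma sum_gen_psi: "(\<Sum>i<h. gen_psi (P i) n) = psi n"
proof -
  have "(\<Sum>i<h. gen_psi (P i) n) = (\<Sum>d=1..n. \<Sum>i<h. gen_ind (P i) d * mangoldt d)"
    unfolding gen_psi_def by (rule sum.swap)
  also have "\<dots> = psi n"
    unfolding psi_def
  proof (intro sum.cong refl)
    fix d
    show "(\<Sum>i<h. gen_ind (P i) d * mangoldt d) = mangoldt d"
    proof (cases "primepow d")
      case True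
      then obtain p k where pk: "prime p" "k > 0" "d = p ^ k" by (auto simp: primepow_def)
      then have "gen_ind (P i) d = of_bool (p \<in> P i)" for i
        by (simp add: gen_ind_def prime_factorization_prime_power prime_gt_0_nat)
      then show ?thesis
        using sum_of_bool_partition[of p] by (simp flip: sum_distrib_right)
    qed (simp add: mangoldt_def)
  qed
  finally show ?thesis .
qed

text \<open>Averaging \<open>gen_psi (P i) n - gen_psi (P j) n\<close> over all \<open>j\<close>
  gives \<open>gen_psi (P i) n - psi n / h\<close>.\<close>

lemma gen_psi_asymptotics:
  assumes i: "i < h"
  shows "(\<lambda>n. (gen_psi (P i) n - 1 / real h * psi n) / real n) \<longlonglongrightarrow> 0"
proof -
  have "(\<lambda>n. (\<Sum>j<h. (gen_psi (P i) n - gen_psi (P j) n) / real n) / real h) \<longlonglongrightarrow> (\<Sum>j<h. 0) / real h"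
    using h by (intro tendsto_divide tendsto_sum tendsto_const gen_psi_diff_littleo balance i) auto
  moreover have "(\<Sum>j<h. (gen_psi (P i) n - gen_psi (P j) n) / real n) / real h = (gen_psi (P i) n - 1 / real h * psi n) / real n" for n
    using h by (simp add: sum_subtractf sum_gen_psi flip: sum_divide_distrib) (simp add: field_simps)
  ultimately show ?thesis by simp
qed

lemma gen_ind_class_count:
  assumes i: "i < h"
  shows "(\<lambda>N. (\<Sum>n=1..N. gen_ind (P i) n) * (ln (real N) powr (1 - 1 / real h) / real N)) \<longlonglongrightarrow> 1 / Gamma (1 / real h)"
proof -
  have \<tau>: "1 / real h > 0" using h by simp
  have "1 / real h * (1 / Gamma (1 / real h + 1)) = 1 / Gamma (1 / real h)"
  proof -
    have "1 / real h \<notin> \<int>\<^sub>\<le>\<^sub>0"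
    proof
      assume "1 / real h \<in> \<int>\<^sub>\<le>\<^sub>0"
      then obtain n where "1 / real h = of_int n" "n \<le> 0" by (elim nonpos_Ints_cases)
      with \<tau> show False by (metis not_less of_int_le_0_iff)
    qed
    then show ?thesis using \<tau> by (simp add: Gamma_plus1)
  qed
  then show ?thesis
    using gen_ind_count_asymptotics[OF \<tau> gen_ind_harmonic_asymptotics[OF \<tau> gen_series_asymptotics[OF i]] gen_psi_asymptotics[OF i]]
    by simp
qed

definition class_union :: "nat set" where
  "class_union = {n. n > 0 \<and> (\<exists>i<h. prime_factors n \<subseteq> P i)}"

lemma class_union_basis: "multiplicative_basis h class_union"
  unfolding multiplicative_basis_def
proof (intro conjI allI impI)
  show "class_union \<subseteq> {0<..}" by (auto simp: class_union_def)
  fix n :: nat assume n: "n > 0"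
  \<comment> \<open>The part of \<open>n\<close> built from one class; it may be 1, which lies in
    every class. The shift matches factors numbered from 1 with classes numbered from 0.\<close>
  define a where "a = (\<lambda>i. \<Prod>p\<in>prime_factors n \<inter> P (i - 1). p ^ multiplicity p n)"
  have "a i \<in> class_union" if i: "i \<in> {1..h}" for i
  proof -
    have "a i > 0" unfolding a_def
      by (intro prod_pos) (auto intro!: prime_gt_0_nat dest: in_prime_factors_imp_prime)
    moreover have "prime_factors (a i) \<subseteq> P (i - 1)"
    proof
      fix q assume "q \<in> prime_factors (a i)"
      then have q: "prime q" "q dvd a i" by (auto simp: prime_factors_dvd)
      then obtain p where p: "p \<in> prime_factors n \<inter> P (i - 1)" "q dvd p ^ multiplicity p n"
        unfolding a_def by (subst (asm) prime_dvd_prod_iff) auto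
      then have "q dvd p" using q prime_dvd_power by blast
      then show "q \<in> P (i - 1)" using p q primes_dvd_imp_eq by auto
    qed
    moreover have "i - 1 < h" using i by auto
    ultimately show ?thesis by (auto simp: class_union_def)
  qed
  moreover have "n = (\<Prod>i=1..h. a i)"
  proof -
    have "(\<Prod>i=1..h. a i) = (\<Prod>i<h. \<Prod>p\<in>prime_factors n \<inter> P i. p ^ multiplicity p n)"
      unfolding a_def by (rule prod.reindex_bij_witness[of _ Suc "\<lambda>i. i - 1"]) auto
    also have "\<dots> = (\<Prod>p\<in>(\<Union>i<h. prime_factors n \<inter> P i). p ^ multiplicity p n)"
      using disj by (subst prod.UNION_disjoint) auto
    also have "(\<Union>i<h. prime_factors n \<inter> P i) = prime_factors n"
      using cover by blast
    also have "(\<Prod>p\<in>prime_factors n. p ^ multiplicity p n) = n"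
      using n by (simp add: prod_prime_factors)
    finally show ?thesis by simp
  qed
  ultimately show "\<exists>a. (\<forall>i\<in>{1..h}. a i \<in> class_union) \<and> n = (\<Prod>i=1..h. a i)" by blast
qed

text \<open>A prime factor of \<open>n > 1\<close> determines the class, whereas 1 is counted by all
  \<open>h\<close> classes.\<close>

lemma sum_gen_ind_class_union:
  assumes "n > 0"
  shows "(\<Sum>i<h. gen_ind (P i) n) = of_bool (n \<in> class_union) + (real h - 1) * of_bool (n = 1)"
proof (cases "n = 1")
  case True
  then show ?thesis using h by (auto simp: gen_ind_def class_union_def)
next
  case False
  then obtain p where p: "prime p" "p dvd n" using prime_factor_nat by blast
  then have pf: "p \<in> prime_factors n" using assms by (simp add: prime_factors_dvd)
  show ?thesis
  proof (cases "n \<in> class_union")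
    case True
    then obtain i where i: "i < h" "prime_factors n \<subseteq> P i" by (auto simp: class_union_def)
    have "gen_ind (P j) n = of_bool (j = i)" if "j < h" for j
      using i that pf disj[of j i p] assms by (auto simp: gen_ind_def)
    then show ?thesis using i True False by simp
  next
    case F: False
    then have "gen_ind (P j) n = 0" if "j < h" for j
      using that assms by (auto simp: gen_ind_def class_union_def)
    then show ?thesis using F False by simp
  qed
qed

lemma counting_function_class_union:
  assumes "x \<ge> 1"
  shows "real (counting_function class_union x) = (\<Sum>i<h. \<Sum>n=1..nat \<lfloor>x\<rfloor>. gen_ind (P i) n) - (real h - 1)"
proof -
  let ?N = "nat \<lfloor>x\<rfloor>"
  have N: "1 \<in> {1..?N}" using assms by (simp add: le_nat_floor)
  have "{a \<in> class_union. real a \<le> x} = {n\<in>{1..?N}. n \<in> class_union}"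
    using assms by (auto simp: class_union_def le_nat_floor Suc_le_eq) linarith+
  then have "real (counting_function class_union x) = (\<Sum>n=1..?N. of_bool (n \<in> class_union))"
    by (simp add: counting_function_def Int_def sum_of_bool_eq conj_commute)
  moreover have "(\<Sum>i<h. \<Sum>n=1..?N. gen_ind (P i) n) = (\<Sum>n=1..?N. of_bool (n \<in> class_union) + (real h - 1) * of_bool (n = 1))"
    by (subst sum.swap) (auto intro!: sum.cong simp: sum_gen_ind_class_union)
  moreover have "(\<Sum>n=1..?N. (real h - 1) * of_bool (n = 1)) = real h - 1"
    using N by (simp flip: sum_distrib_left)
  ultimately show ?thesis by (simp only: sum.distrib add_diff_cancel_right')
qed

text \<open>Transfers the limit from integers \<open>N = \<lfloor>x\<rfloor>\<close> to real
  \<open>x\<close>: the normalising factors at \<open>x\<close> and at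
  \<open>\<lfloor>x\<rfloor>\<close> have ratio tending to 1, and the correction
  \<open>h - 1\<close> for the number 1 is negligible.\<close>

lemma counting_function_class_union_asymptotics:
  "((\<lambda>x::real. real (counting_function class_union x) * (ln x powr (1 - 1 / real h) / x)) \<longlongrightarrow> real h / Gamma (1 / real h)) at_top"
proof -
  define a where "a = 1 - 1 / real h"
  define S where "S = (\<lambda>N. \<Sum>i<h. \<Sum>n=1..N. gen_ind (P i) n)"
  have "(\<lambda>N. \<Sum>i<h. (\<Sum>n=1..N. gen_ind (P i) n) * (ln (real N) powr a / real N)) \<longlonglongrightarrow> (\<Sum>i<h. 1 / Gamma (1 / real h))"
    unfolding a_def by (intro tendsto_sum gen_ind_class_count) auto
  then have S: "(\<lambda>N. S N * (ln (real N) powr a / real N)) \<longlonglongrightarrow> real h / Gamma (1 / real h)"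
    by (simp only: S_def sum_distrib_right[symmetric] sum_constant card_lessThan) simp
  have fl: "filterlim (\<lambda>x::real. nat \<lfloor>x\<rfloor>) sequentially at_top"
    by (intro filterlim_compose[OF filterlim_nat_sequentially] filterlim_floor_sequentially)
  have "((\<lambda>x. S (nat \<lfloor>x\<rfloor>) * (ln (of_int \<lfloor>x\<rfloor>) powr a / of_int \<lfloor>x\<rfloor>) * ((ln x powr a / x) / (ln (of_int \<lfloor>x\<rfloor>) powr a / of_int \<lfloor>x\<rfloor>)) - (real h - 1) * (ln x powr a / x))
     \<longlongrightarrow> real h / Gamma (1 / real h) * 1 - (real h - 1) * 0) at_top"
  proof (intro tendsto_diff tendsto_mult tendsto_const)
    have "((\<lambda>x::real. S (nat \<lfloor>x\<rfloor>) * (ln (real (nat \<lfloor>x\<rfloor>)) powr a / real (nat \<lfloor>x\<rfloor>))) \<longlongrightarrow> real h / Gamma (1 / real h)) at_top"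
      by (rule filterlim_compose[OF S fl])
    then show "((\<lambda>x::real. S (nat \<lfloor>x\<rfloor>) * (ln (of_int \<lfloor>x\<rfloor>) powr a / of_int \<lfloor>x\<rfloor>)) \<longlongrightarrow> real h / Gamma (1 / real h)) at_top"
      by (rule Lim_transform_eventually) (use eventually_ge_at_top[of 0] in eventually_elim, simp)
    have "((\<lambda>x::real. ln x / ln (of_int \<lfloor>x\<rfloor>)) \<longlongrightarrow> 1) at_top"
    proof (rule tendsto_sandwich)
      have bounds: "1 \<le> ln x / ln (of_int \<lfloor>x\<rfloor>) \<and> ln x / ln (of_int \<lfloor>x\<rfloor>) \<le> ln x / ln (x - 1)"
        if "x \<ge> 3" for x :: real
      proof -
        have x: "x - 1 \<le> of_int \<lfloor>x\<rfloor>" "of_int \<lfloor>x\<rfloor> \<le> x" by linarith+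
        then have "0 < ln (x - 1)" "ln (x - 1) \<le> ln (of_int \<lfloor>x\<rfloor>)" "ln (of_int \<lfloor>x\<rfloor>) \<le> ln x"
          using that by (auto intro!: ln_gt_zero ln_mono)
        then show ?thesis by (auto intro!: divide_left_mono mult_pos_pos)
      qed
      show "eventually (\<lambda>x::real. 1 \<le> ln x / ln (of_int \<lfloor>x\<rfloor>)) at_top"
        using eventually_ge_at_top[of 3] by eventually_elim (use bounds in blast)
      show "eventually (\<lambda>x::real. ln x / ln (of_int \<lfloor>x\<rfloor>) \<le> ln x / ln (x - 1)) at_top"
        using eventually_ge_at_top[of 3] by eventually_elim (use bounds in blast)
      show "((\<lambda>x::real. ln x / ln (x - 1)) \<longlongrightarrow> 1) at_top" by real_asymp
    qed auto
    moreover have "((\<lambda>x::real. of_int \<lfloor>x\<rfloor> / x :: real) \<longlongrightarrow> 1) at_top"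
    proof (rule tendsto_sandwich)
      show "eventually (\<lambda>x::real. (x - 1) / x \<le> of_int \<lfloor>x\<rfloor> / x) at_top"
        using eventually_gt_at_top[of 0] by eventually_elim (intro divide_right_mono; linarith)
      show "eventually (\<lambda>x::real. of_int \<lfloor>x\<rfloor> / x \<le> 1) at_top"
        using eventually_gt_at_top[of 0] by eventually_elim (simp add: divide_le_eq)
      show "((\<lambda>x::real. (x - 1) / x) \<longlongrightarrow> 1) at_top" by real_asymp
    qed auto
    ultimately have "((\<lambda>x::real. (ln x / ln (of_int \<lfloor>x\<rfloor>)) powr a * (of_int \<lfloor>x\<rfloor> / x)) \<longlongrightarrow> 1 powr a * 1) at_top"
      by (intro tendsto_mult tendsto_powr tendsto_const) auto
    then have "((\<lambda>x::real. (ln x / ln (of_int \<lfloor>x\<rfloor>)) powr a * (of_int \<lfloor>x\<rfloor> / x)) \<longlongrightarrow> 1) at_top"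
      by simp
    then show "((\<lambda>x. ln x powr a / x / (ln (of_int \<lfloor>x\<rfloor>) powr a / of_int \<lfloor>x\<rfloor>)) \<longlongrightarrow> 1) at_top"
    proof (rule Lim_transform_eventually)
      show "eventually (\<lambda>x::real. (ln x / ln (of_int \<lfloor>x\<rfloor>)) powr a * (of_int \<lfloor>x\<rfloor> / x) =
        ln x powr a / x / (ln (of_int \<lfloor>x\<rfloor>) powr a / of_int \<lfloor>x\<rfloor>)) at_top"
        using eventually_ge_at_top[of 2]
      proof eventually_elim
        case (elim x)
        then have "\<lfloor>x\<rfloor> \<ge> 2" by (simp add: le_floor_iff)
        then have "ln (of_int \<lfloor>x\<rfloor> :: real) > 0" by (intro ln_gt_zero) simp
        then show ?case using elim by (simp add: powr_divide)
      qed
    qed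
    have "a < 1" using h by (simp add: a_def)
    then show "((\<lambda>x. ln x powr a / x) \<longlongrightarrow> 0) at_top" by real_asymp
  qed
  then have "((\<lambda>x. S (nat \<lfloor>x\<rfloor>) * (ln (of_int \<lfloor>x\<rfloor>) powr a / of_int \<lfloor>x\<rfloor>) * ((ln x powr a / x) / (ln (of_int \<lfloor>x\<rfloor>) powr a / of_int \<lfloor>x\<rfloor>)) - (real h - 1) * (ln x powr a / x))
     \<longlongrightarrow> real h / Gamma (1 / real h)) at_top" by simp
  then show ?thesis
  proof (rule Lim_transform_eventually)
    show "eventually (\<lambda>x. S (nat \<lfloor>x\<rfloor>) * (ln (of_int \<lfloor>x\<rfloor>) powr a / of_int \<lfloor>x\<rfloor>) * ((ln x powr a / x) / (ln (of_int \<lfloor>x\<rfloor>) powr a / of_int \<lfloor>x\<rfloor>)) - (real h - 1) * (ln x powr a / x)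
       = real (counting_function class_union x) * (ln x powr (1 - 1 / real h) / x)) at_top"
      using eventually_ge_at_top[of 2]
    proof eventually_elim
      case (elim x)
      define q where "q = ln (of_int \<lfloor>x\<rfloor>) powr a / of_int \<lfloor>x\<rfloor>"
      define r where "r = ln x powr a / x"
      have "q \<noteq> 0"
      proof -
        define y :: real where "y = of_int \<lfloor>x\<rfloor>"
        have "y > 1" using elim unfolding y_def by linarith
        then have "ln y > 0" by (rule ln_gt_zero)
        then show ?thesis using \<open>y > 1\<close> by (simp add: q_def flip: y_def)
      qed
      moreover have cf: "real (counting_function class_union x) = S (nat \<lfloor>x\<rfloor>) - (real h - 1)"
        using counting_function_class_union[of x] elim by (simp add: S_def)
      ultimately have "S (nat \<lfloor>x\<rfloor>) * q * (r / q) - (real h - 1) * r = real (counting_function class_union x) * r"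
        by (simp add: left_diff_distrib)
      then show ?case unfolding q_def r_def a_def .
    qed
  qed
qed

end

theorem corollary9:
  fixes h :: nat
  assumes "h > 0"
  shows "\<exists>A. multiplicative_basis h A \<and>
    Limsup at_top (\<lambda>x::real.
      ereal (real (counting_function A x) * (ln x powr (1 - 1 / real h) / x)))
    = ereal (real h / Gamma (1 / real h))"
proof -
  define w where "w = prime_weight 1"
  \<comment> \<open>All natural numbers are distributed, which makes the classes a partition;
    composite indices have weight 0 and leave the loads unchanged.\<close>
  define P where "P = (\<lambda>i. {k. greedy_class w h k = i})"
  have w: "w n \<ge> 0" for n by (simp add: w_def prime_weight_nonneg)
  have cover: "\<exists>i<h. k \<in> P i" for k
    using greedy_class_less[OF w assms] by (auto simp: P_def)
  have disj: "i = j" if "i < h" "j < h" "k \<in> P i" "k \<in> P j" for i j k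
    using that by (simp add: P_def)
  have "weight_diff (P i) (P j) n = greedy_load w h n i - greedy_load w h n j" for i j n
    by (simp add: weight_diff_def greedy_load_eq_sum P_def w_def sum_subtractf left_diff_distrib)
  then have balance: "(\<lambda>n. weight_diff (P i) (P j) n * ln (real n)) \<longlonglongrightarrow> 0" if "i < h" "j < h" for i j
    using greedy_prime_balance[OF assms that] by (simp add: w_def)
  note class_facts = assms cover disj balance
  have "((\<lambda>x::real. real (counting_function (class_union h P) x) * (ln x powr (1 - 1 / real h) / x))
    \<longlongrightarrow> real h / Gamma (1 / real h)) at_top"
    by (rule counting_function_class_union_asymptotics; fact class_facts)
  then have "Limsup at_top (\<lambda>x::real. ereal (real (counting_function (class_union h P) x) * (ln x powr (1 - 1 / real h) / x)))
    = ereal (real h / Gamma (1 / real h))"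
    by (intro lim_imp_Limsup tendsto_ereal) auto
  moreover have "multiplicative_basis h (class_union h P)"
    by (rule class_union_basis; fact class_facts)
  ultimately show ?thesis by blast
qed

end
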